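(* Let $T$ be a tree and $v$ a vertex of $T$. Then $T$ is $(e)$-positive at $v$ if and only if $T$ is a path with $v$ as one of its endpoints.
   Context: All graphs are finite and simple with nonempty vertex set. The one-vertex tree is regarded as a path whose only vertex is an endpoint. A labelled graph on $d$ vertices is a graph with vertex set $[d]=\{1,\dots,d\}$. For a set partition $\pi$ of $[d]$, let $B_{\pi,i}$ be the block containing $i$, and let $e_\pi=\sum x_{i_1}\cdots x_{i_d}$ in noncommuting variables $x_1,x_2,\dots$, summed over all tuples $(i_1,\dots,i_d)$ of positive integers with $i_j\ne i_k$ whenever $j\neq k$ and $B_{\pi,j}=B_{\pi,k}$. The $e_\pi$, over set partitions $\pi$ of $[d]$, form a $\mathbb Q$-basis of $\mathrm{NCSym}^d$, the degree-$d$ part of the algebra of symmetric functions in noncommuting variables. For $d\ge 1$ let $\mathrm{type}(\pi)=(\lambda,b)$, where $b=|B_{\pi,d}|$ and $\lambda$ is the integer partition (possibly empty) formed by the sizes of the other blocks. $\mathrm{UBCSym}^d$ is the $\mathbb Q$-vector space with basis $\{e_{(\lambda,b)}\}$ over pairs of a partition $\lambda$ and an integer $b\ge 1$ with $|\lambda|+b=d$, and $\nu:\mathrm{NCSym}^d\to\mathrm{UBCSym}^d$ is the linear map with $\nu(e_\pi)=e_{\mathrm{type}(\pi)}$. For a labelled graph $G$ on $d$ vertices, $Y_G=\sum_\kappa x_{\kappa(1)}\cdots x_{\kappa(d)}\in\mathrm{NCSym}^d$, summed over all proper colourings $\kappa:[d]\to\mathbb Z_{>0}$ of $G$, and $y_G=\nu(Y_G)$.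 For a graph $G$ on $d$ vertices with distinguished vertex $v$, $y_{G:v}=y_{G'}$ where $G'$ is any labelling of $G$ by $[d]$ in which $v$ has label $d$ (this does not depend on the choice of such labelling). $G$ is $(e)$-positive at $v$ if all coefficients of $y_{G:v}$ in the basis $\{e_{(\lambda,b)}\}$ are nonnegative. *)

theory Defs
  imports
    "HOL-Library.Function_Algebras"
    "HOL-Library.FuncSet"
    "HOL-Library.Disjoint_Sets"
    "HOL-Library.Multiset"
    "HOL-Library.Poly_Mapping"
    Complex_Main
begin

section \<open>Graphs\<close>

text \<open>A graph is given by its vertex set and a set of two-element edges.\<close>

definition simple_graph :: "'a set \<Rightarrow> 'a set set \<Rightarrow> bool" where
  "simple_graph V E \<longleftrightarrow> finite V \<and> V \<noteq> {} \<and> (\<forall>e\<in>E. e \<subseteq> V \<and> card e = 2)"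

definition connected_graph :: "'a set \<Rightarrow> 'a set set \<Rightarrow> bool" where
  "connected_graph V E \<longleftrightarrow> (\<forall>u\<in>V. \<forall>w\<in>V. (u, w) \<in> {(a, b). {a, b} \<in> E}\<^sup>*)"

definition consecutive_pairs :: "'a list \<Rightarrow> 'a set set" where
  "consecutive_pairs xs = {{xs ! i, xs ! Suc i} | i. Suc i < length xs}"

definition graph_cycle :: "'a set set \<Rightarrow> 'a list \<Rightarrow> bool" where
  "graph_cycle E xs \<longleftrightarrow> distinct xs \<and> length xs \<ge> 3 \<and>
     consecutive_pairs xs \<subseteq> E \<and> {last xs, hd xs} \<in> E"

definition tree_graph :: "'a set \<Rightarrow> 'a set set \<Rightarrow> bool" where
  "tree_graph V E \<longleftrightarrow> simple_graph V E \<and> connected_graph V E \<and> (\<nexists>xs. graph_cycle E xs)"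

text \<open>The list enumerates the vertices along the path.  A one-element list gives the
  one-vertex path, whose only vertex is an endpoint.\<close>

definition path_with_endpoint :: "'a set \<Rightarrow> 'a set set \<Rightarrow> 'a \<Rightarrow> bool" where
  "path_with_endpoint V E v \<longleftrightarrow>
     (\<exists>xs. xs \<noteq> [] \<and> distinct xs \<and> set xs = V \<and> E = consecutive_pairs xs \<and>
           (v = hd xs \<or> v = last xs))"


section \<open>Symmetric functions in noncommuting variables\<close>

text \<open>A formal power series over the rationals in noncommuting variables
  \<open>x\<^sub>1, x\<^sub>2, \<dots>\<close> is represented by its coefficient function on words; the word
  \<open>[i\<^sub>1, \<dots>, i\<^sub>d]\<close> stands for the monomial \<open>x\<^bsub>i\<^sub>1\<^esub> \<cdots> x\<^bsub>i\<^sub>d\<^esub>\<close>.\<close>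

type_synonym nc_series = "nat list \<Rightarrow> rat"

definition nc_scale :: "rat \<Rightarrow> nc_series \<Rightarrow> nc_series" where
  "nc_scale c f = (\<lambda>w. c * f w)"

text \<open>The sum of the monomials \<open>x\<^bsub>\<kappa>(1)\<^esub> \<cdots> x\<^bsub>\<kappa>(d)\<^esub>\<close> over all
  \<open>\<kappa> : [d] \<rightarrow> \<int>\<^bsub>>0\<^esub>\<close> satisfying a predicate: the coefficient of a word is the number of
  such \<open>\<kappa>\<close> producing it.\<close>

definition word_sum :: "nat \<Rightarrow> ((nat \<Rightarrow> nat) \<Rightarrow> bool) \<Rightarrow> nc_series" where
  "word_sum d P = (\<lambda>w. of_nat (card
     {\<kappa> \<in> {1..d} \<rightarrow>\<^sub>E {1..}. P \<kappa> \<and> map \<kappa> [1..<Suc d] = w}))"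

definition set_partitions :: "nat \<Rightarrow> nat set set set" where
  "set_partitions d = {\<pi>. partition_on {1..d} \<pi>}"

definition block :: "nat set set \<Rightarrow> nat \<Rightarrow> nat set" where
  "block \<pi> i = (THE B. B \<in> \<pi> \<and> i \<in> B)"

definition nc_e :: "nat \<Rightarrow> nat set set \<Rightarrow> nc_series" where
  "nc_e d \<pi> = word_sum d (\<lambda>\<kappa>. \<forall>j\<in>{1..d}. \<forall>k\<in>{1..d}.
     j \<noteq> k \<and> block \<pi> j = block \<pi> k \<longrightarrow> \<kappa> j \<noteq> \<kappa> k)"

text \<open>\<open>Y\<^sub>G\<close> for the labelled graph with vertex set \<open>[d]\<close> and edge set \<open>E\<close>.\<close>

definition nc_Y :: "nat \<Rightarrow> nat set set \<Rightarrow> nc_series" where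
  "nc_Y d E = word_sum d (\<lambda>\<kappa>. \<forall>j\<in>{1..d}. \<forall>k\<in>{1..d}. {j, k} \<in> E \<longrightarrow> \<kappa> j \<noteq> \<kappa> k)"


section \<open>UBCSym and the map \<open>\<nu>\<close>\<close>

text \<open>An integer partition is the multiset of its parts.  The space with basis
  \<open>e\<^bsub>(\<lambda>,b)\<^esub>\<close> is the free vector space on the pairs \<open>(\<lambda>, b)\<close>; its degree-\<open>d\<close>
  component is spanned by the basis vectors indexed by \<open>ubc_index d\<close>.\<close>

type_synonym ubc = "(nat multiset \<times> nat) \<Rightarrow>\<^sub>0 rat"

definition ubc_scale :: "rat \<Rightarrow> ubc \<Rightarrow> ubc" where
  "ubc_scale c f = Poly_Mapping.map ((*) c) f"

definition ubc_index :: "nat \<Rightarrow> (nat multiset \<times> nat) set" where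
  "ubc_index d = {(\<mu>, b). 0 \<notin># \<mu> \<and> b \<ge> 1 \<and> sum_mset \<mu> + b = d}"

definition ubc_e :: "nat multiset \<times> nat \<Rightarrow> ubc" where
  "ubc_e t = Poly_Mapping.single t 1"

definition partition_type :: "nat \<Rightarrow> nat set set \<Rightarrow> nat multiset \<times> nat" where
  "partition_type d \<pi> =
     (image_mset card (mset_set (\<pi> - {block \<pi> d})), card (block \<pi> d))"

lemma lookup_ubc_scale [simp]:
  "Poly_Mapping.lookup (ubc_scale c f) t = c * Poly_Mapping.lookup f t"
  by (simp add: ubc_scale_def Poly_Mapping.map.rep_eq when_def)

interpretation nc_ubc: vector_space_pair nc_scale ubc_scale
  by unfold_locales
    (auto simp: nc_scale_def algebra_simps lookup_add intro!: poly_mapping_eqI)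

text \<open>\<open>\<nu>\<close> is the linear map sending each \<open>e\<^sub>\<pi>\<close> to \<open>e\<^bsub>type(\<pi>)\<^esub>\<close>.  Since
  \<open>\<pi> \<mapsto> e\<^sub>\<pi>\<close> is injective with linearly independent image, \<open>construct\<close> yields a linear
  map with these values.  It is defined on all series; only its restriction to the span of the
  \<open>e\<^sub>\<pi>\<close>, that is, to the degree-\<open>d\<close> symmetric functions, is meaningful (outside it the
  values depend on an arbitrary extension of the basis).\<close>

definition nu :: "nat \<Rightarrow> nc_series \<Rightarrow> ubc" where
  "nu d = nc_ubc.construct (nc_e d ` set_partitions d)
     (\<lambda>f. ubc_e (partition_type d (the_inv_into (set_partitions d) (nc_e d) f)))"

definition ubc_y :: "nat \<Rightarrow> nat set set \<Rightarrow> ubc" where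
  "ubc_y d E = nu d (nc_Y d E)"

text \<open>The result does not depend on the labelling chosen.\<close>

definition ubc_y_at :: "'a set \<Rightarrow> 'a set set \<Rightarrow> 'a \<Rightarrow> ubc" where
  "ubc_y_at V E v =
     (let l = (SOME l. bij_betw l V {1..card V} \<and> l v = card V)
      in ubc_y (card V) ((`) l ` E))"

definition e_positive_at :: "'a set \<Rightarrow> 'a set set \<Rightarrow> 'a \<Rightarrow> bool" where
  "e_positive_at V E v \<longleftrightarrow>
     (\<forall>t\<in>ubc_index (card V). Poly_Mapping.lookup (ubc_y_at V E v) t \<ge> 0)"

end

theory Submission
  imports Defs "HOL-Combinatorics.Transposition"
begin

text \<open>Words of length \<open>d\<close> are colourings of the vertices, so \<open>e\<^sub>\<pi>\<close>, \<open>Y\<^sub>G\<close> and the power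
  sums \<open>p\<^sub>\<tau>\<close> (colourings constant on the blocks of \<open>\<tau>\<close>) become functions of colourings. The
  \<open>p\<^sub>\<tau>\<close> are linearly independent, and \<open>e\<^sub>\<pi>\<close> is a combination of the \<open>p\<^sub>\<tau>\<close> with \<open>\<tau>\<close> refining
  \<open>\<pi>\<close>, in which \<open>p\<^sub>\<tau>\<close> occurs with a nonzero coefficient whose sign depends on \<open>\<tau>\<close> only. Hence
  the \<open>e\<^sub>\<pi>\<close> are a basis of the span of the \<open>p\<^sub>\<tau>\<close>.

  For a path, appending a vertex \<open>y\<close> to the endpoint \<open>x\<close> replaces \<open>e\<^bsub>(\<lambda>,b)\<^esub>\<close> by
  \<open>(1 - 1/b) e\<^bsub>(\<lambda> \<union> b, 1)\<^esub> + (1/b) e\<^bsub>(\<lambda>, b+1)\<^esub>\<close>, which preserves nonnegativity.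

  Conversely, \<open>p\<^sub>\<tau>\<close> occurs in \<open>Y\<^sub>T\<close> only if the blocks of \<open>\<tau>\<close> are connected in \<open>T\<close>, and
  \<open>p\<close> of the one-block partition does occur. Comparing coefficients of \<open>p\<^sub>\<tau>\<close> for partitions with at
  most two blocks, \<open>(e)\<close>-positivity yields for every \<open>b < d\<close> a connected set of \<open>b\<close> vertices that
  contains \<open>v\<close> and has a connected complement. In a tree this forces a path starting at \<open>v\<close>.\<close>

section \<open>Power sums and elementary functions of set partitions\<close>

text \<open>Partitions are handled through their equivalence relations: refinement becomes inclusion
  of sets of pairs, and the number of pairs serves as the measure in inductions and extremal
  choices.\<close>

definition same_block :: "'a set set \<Rightarrow> ('a \<times> 'a) set" where
  "same_block \<pi> = {(a, b). \<exists>B\<in>\<pi>. a \<in> B \<and> b \<in> B}"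

text \<open>The partition generated by \<open>R\<close>; for the adjacency relation of an edge set
  these are the connected components. Symmetrising allows \<open>R\<close> to consist of one-way
  pairs, such as parent and child in a forest.\<close>

definition components :: "'a set \<Rightarrow> ('a \<times> 'a) set \<Rightarrow> 'a set set" where
  "components V R = V // {(a, b). a \<in> V \<and> b \<in> V \<and> (a, b) \<in> (R \<union> R\<inverse>)\<^sup>*}"

definition agree :: "('a \<times> 'a) set \<Rightarrow> ('a \<Rightarrow> nat) \<Rightarrow> rat" where
  "agree R \<kappa> = of_bool (\<forall>(a, b)\<in>R. \<kappa> a = \<kappa> b)"

text \<open>Colours range over all naturals, 0 included; \<open>nc_e_independent\<close> shifts them
  to positive letters.\<close>

definition elem :: "'a set set \<Rightarrow> ('a \<Rightarrow> nat) \<Rightarrow> rat" where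
  "elem \<pi> \<kappa> = of_bool (\<forall>(a, b)\<in>same_block \<pi>. a \<noteq> b \<longrightarrow> \<kappa> a \<noteq> \<kappa> b)"

abbreviation parts :: "'a set \<Rightarrow> 'a set set set" where
  "parts V \<equiv> {\<pi>. partition_on V \<pi>}"

lemma equiv_same_block: "partition_on V \<pi> \<Longrightarrow> equiv V (same_block \<pi>)"
  unfolding same_block_def by (rule equiv_partition_on)

lemma same_block_subset: "partition_on V \<pi> \<Longrightarrow> same_block \<pi> \<subseteq> V \<times> V"
  using equiv_same_block equiv_type by blast

lemma same_block_refl: "partition_on V \<pi> \<Longrightarrow> a \<in> V \<Longrightarrow> (a, a) \<in> same_block \<pi>"
  using equiv_same_block by (metis equiv_class_eq_iff)

lemma same_block_sym: "(a, b) \<in> same_block \<pi> \<Longrightarrow> (b, a) \<in> same_block \<pi>"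
  by (auto simp: same_block_def)

lemma same_block_trans:
  "partition_on V \<pi> \<Longrightarrow> (a, b) \<in> same_block \<pi> \<Longrightarrow> (b, c) \<in> same_block \<pi> \<Longrightarrow> (a, c) \<in> same_block \<pi>"
  using equiv_same_block unfolding equiv_def by (metis transD)

lemma quotient_same_block: "partition_on V \<pi> \<Longrightarrow> V // same_block \<pi> = \<pi>"
  unfolding same_block_def by (rule partition_on_eq_quotient)

lemma same_block_eqD:
  "partition_on V \<pi> \<Longrightarrow> partition_on V \<tau> \<Longrightarrow> same_block \<pi> = same_block \<tau> \<Longrightarrow> \<pi> = \<tau>"
  by (metis quotient_same_block)

lemma same_block_quotient: "equiv V r \<Longrightarrow> same_block (V // r) = r"
proof -
  assume r: "equiv V r"
  show ?thesis
  proof (intro set_eqI iffI, goal_cases)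
    case (1 x)
    then obtain a b B where "x = (a, b)" "B \<in> V // r" "a \<in> B" "b \<in> B"
      by (auto simp: same_block_def)
    then show ?case using r by (metis quotient_eq_iff)
  next
    case (2 x)
    then obtain a b where x: "x = (a, b)" "(a, b) \<in> r" by (cases x) auto
    then have "a \<in> V" "b \<in> V" using r by (auto dest: equiv_type)
    then have "r `` {a} \<in> V // r" "a \<in> r `` {a}" "b \<in> r `` {a}"
      using x r equiv_class_self[OF r] by (auto intro: quotientI)
    then show ?case using x by (auto simp: same_block_def)
  qed
qed

lemma equiv_closure: "equiv V {(a, b). a \<in> V \<and> b \<in> V \<and> (a, b) \<in> (R \<union> R\<inverse>)\<^sup>*}"
proof (rule equivI)
  show "sym {(a, b). a \<in> V \<and> b \<in> V \<and> (a, b) \<in> (R \<union> R\<inverse>)\<^sup>*}"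
    by (auto simp: sym_def) (metis converse_Un converse_converse rtrancl_converseI sup_commute)
qed (auto simp: refl_on_def trans_def)

lemma components_parts [intro]: "partition_on V (components V R)"
  unfolding components_def by (rule partition_on_quotient[OF equiv_closure])

lemma same_block_components:
  "same_block (components V R) = {(a, b). a \<in> V \<and> b \<in> V \<and> (a, b) \<in> (R \<union> R\<inverse>)\<^sup>*}"
  unfolding components_def by (rule same_block_quotient[OF equiv_closure])

lemma subset_same_block_components: "R \<subseteq> V \<times> V \<Longrightarrow> R \<subseteq> same_block (components V R)"
  unfolding same_block_components by auto

text \<open>Each \<open>R\<close>-step, forwards or backwards, stays inside a block of
  \<open>\<pi>\<close>, hence so does every chain. With \<open>subset_same_block_components\<close>
  this makes the generated partition the finest one whose relation contains
  \<open>R\<close>.\<close>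

lemma same_block_components_le:
  assumes "partition_on V \<pi>" "R \<subseteq> same_block \<pi>"
  shows "same_block (components V R) \<subseteq> same_block \<pi>"
proof -
  have "(a, b) \<in> (R \<union> R\<inverse>)\<^sup>* \<Longrightarrow> a \<in> V \<Longrightarrow> (a, b) \<in> same_block \<pi>" for a b
  proof (induction rule: rtrancl_induct)
    case base
    then show ?case using same_block_refl assms(1) by metis
  next
    case (step y z)
    then have "(y, z) \<in> same_block \<pi>" using assms(2) same_block_sym[of z y \<pi>] by auto
    with step.IH[OF step.prems] show ?case by (rule same_block_trans[OF assms(1)])
  qed
  then show ?thesis unfolding same_block_components by auto
qed

lemma components_same_block: "partition_on V \<pi> \<Longrightarrow> components V (same_block \<pi>) = \<pi>"
  by (meson components_parts same_block_components_le same_block_eqD same_block_subset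
      subset_antisym subset_refl subset_same_block_components)

text \<open>Equality of colours propagates along chains of \<open>R\<close>-steps, so a power sum
  depends only on the partition that its relation generates.\<close>

lemma agree_components:
  assumes "R \<subseteq> V \<times> V"
  shows "agree (same_block (components V R)) = agree R"
proof
  fix \<kappa> :: "'a \<Rightarrow> nat"
  have "(a, b) \<in> (R \<union> R\<inverse>)\<^sup>* \<Longrightarrow> \<forall>(a, b)\<in>R. \<kappa> a = \<kappa> b \<Longrightarrow> \<kappa> a = \<kappa> b" for a b
    by (induction rule: rtrancl_induct) auto
  then show "agree (same_block (components V R)) \<kappa> = agree R \<kappa>"
    using subset_same_block_components[OF assms]
    unfolding agree_def same_block_components by (intro arg_cong[of _ _ of_bool]) blast
qed

lemma agree_mult: "agree R \<kappa> * agree S \<kappa> = agree (R \<union> S) \<kappa>"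
  by (auto simp: agree_def)

lemma agree_Union_prod:
  "finite I \<Longrightarrow> (\<Prod>i\<in>I. agree (R i) \<kappa>) = agree (\<Union>i\<in>I. R i) \<kappa>"
  by (induction I rule: finite_induct) (auto simp: agree_mult, simp add: agree_def)

section \<open>Linear independence of the power sums\<close>

lemma finite_parts: "finite V \<Longrightarrow> finite (parts V)"
  by (rule finitely_many_partition_on)

lemma finite_same_block: "finite V \<Longrightarrow> partition_on V \<pi> \<Longrightarrow> finite (same_block \<pi>)"
  using finite_subset[OF same_block_subset] by blast

text \<open>Among the partitions with nonzero coefficient take \<open>\<tau>\<close> with the fewest
  related pairs, and evaluate at a colouring whose colour classes are exactly the blocks of
  \<open>\<tau>\<close>. Only refinements of \<open>\<tau>\<close> survive, and minimality leaves
  \<open>\<tau>\<close> alone.\<close>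

lemma agree_same_block_independent:
  fixes V :: "nat set"
  assumes V: "finite V" and zero: "\<And>\<kappa>. (\<Sum>\<tau>\<in>parts V. a \<tau> * agree (same_block \<tau>) \<kappa>) = 0"
    and "partition_on V \<tau>"
  shows "a \<tau> = 0"
proof (rule ccontr)
  assume "a \<tau> \<noteq> 0"
  with assms(3) obtain \<tau> where \<tau>: "partition_on V \<tau>" "a \<tau> \<noteq> 0"
    and min: "\<And>\<sigma>. partition_on V \<sigma> \<Longrightarrow> a \<sigma> \<noteq> 0 \<Longrightarrow> card (same_block \<tau>) \<le> card (same_block \<sigma>)"
    using ex_has_least_nat[of "\<lambda>\<tau>. partition_on V \<tau> \<and> a \<tau> \<noteq> 0" \<tau> "\<lambda>\<tau>. card (same_block \<tau>)"] by blast
  \<comment> \<open>Every vertex is coloured by the least element of its block, so that colours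
    agree exactly within blocks.\<close>
  define \<kappa> where "\<kappa> j = (LEAST i. (i, j) \<in> same_block \<tau>)" for j
  have \<kappa>: "\<kappa> i = \<kappa> j \<longleftrightarrow> (i, j) \<in> same_block \<tau>" if "i \<in> V" "j \<in> V" for i j
  proof
    have "(\<kappa> i, i) \<in> same_block \<tau>" "(\<kappa> j, j) \<in> same_block \<tau>"
      unfolding \<kappa>_def using that \<tau>(1) by (meson LeastI same_block_refl)+
    then show "\<kappa> i = \<kappa> j \<Longrightarrow> (i, j) \<in> same_block \<tau>"
      by (metis \<tau>(1) same_block_sym same_block_trans)
  next
    assume "(i, j) \<in> same_block \<tau>"
    then have "(k, i) \<in> same_block \<tau> \<longleftrightarrow> (k, j) \<in> same_block \<tau>" for k
      by (metis \<tau>(1) same_block_sym same_block_trans)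
    then show "\<kappa> i = \<kappa> j" by (simp add: \<kappa>_def)
  qed
  have "a \<sigma> * agree (same_block \<sigma>) \<kappa> = (if \<sigma> = \<tau> then a \<tau> else 0)" if \<sigma>: "\<sigma> \<in> parts V" for \<sigma>
  proof (cases "a \<sigma> * agree (same_block \<sigma>) \<kappa> = 0")
    case True
    moreover have "agree (same_block \<tau>) \<kappa> = 1"
      using \<kappa> same_block_subset[OF \<tau>(1)] by (auto simp: agree_def)
    ultimately show ?thesis by auto
  next
    case False
    then have "same_block \<sigma> \<subseteq> same_block \<tau>"
      using \<sigma> \<kappa> same_block_subset[of V \<sigma>] by (fastforce simp: agree_def)
    moreover have "card (same_block \<tau>) \<le> card (same_block \<sigma>)" using False \<sigma> min by auto
    ultimately have "same_block \<sigma> = same_block \<tau>"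
      using card_seteq[OF finite_same_block[OF V \<tau>(1)]] by blast
    then have "\<sigma> = \<tau>" using same_block_eqD \<sigma> \<tau>(1) by blast
    then show ?thesis using \<kappa> same_block_subset[OF \<tau>(1)] by (auto simp: agree_def)
  qed
  then have "(\<Sum>\<sigma>\<in>parts V. a \<sigma> * agree (same_block \<sigma>) \<kappa>) = a \<tau>"
    using \<tau>(1) finite_parts[OF V] by (simp add: sum.delta)
  with zero[of \<kappa>] \<tau>(2) show False by simp
qed

section \<open>Power sum expansion of the elementary functions by increasing forests\<close>

text \<open>Increasing forests inside the blocks of \<open>\<pi>\<close>: \<open>g j\<close> is the
  parent of \<open>j\<close>, and \<open>g j = j\<close> marks a root.\<close>

definition forests :: "nat set \<Rightarrow> nat set set \<Rightarrow> (nat \<Rightarrow> nat) set" where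
  "forests V \<pi> = (\<Pi>\<^sub>E j\<in>V. {i. i \<le> j \<and> (i, j) \<in> same_block \<pi>})"

text \<open>Roots contribute loops, which affect neither the agreement condition nor the
  components.\<close>

definition forest_edges :: "nat set \<Rightarrow> (nat \<Rightarrow> nat) \<Rightarrow> (nat \<times> nat) set" where
  "forest_edges V g = (\<lambda>j. (g j, j)) ` V"

definition forest_sign :: "nat set \<Rightarrow> (nat \<Rightarrow> nat) \<Rightarrow> rat" where
  "forest_sign V g = (\<Prod>j\<in>V. if g j = j then 1 else -1)"

lemma finite_forests: "finite V \<Longrightarrow> finite (forests V \<pi>)"
  unfolding forests_def by (intro finite_PiE) (auto intro: finite_subset[of _ "{.._}"])

lemma forestsD:
  "g \<in> forests V \<pi> \<Longrightarrow> j \<in> V \<Longrightarrow> g j \<le> j \<and> (g j, j) \<in> same_block \<pi>"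
  by (auto simp: forests_def)

lemma forest_edges_subset: "g \<in> forests V \<pi> \<Longrightarrow> forest_edges V g \<subseteq> same_block \<pi>"
  by (auto simp: forest_edges_def dest: forestsD)

text \<open>The factor of \<open>j\<close> in the product below is the indicator of \<open>\<kappa> j\<close> differing from the
  colours of the smaller elements of its block, provided these are pairwise different; at the first
  \<open>j\<close> repeating a colour of its block there is exactly one such repetition, and the factor is 0.\<close>

lemma elem_eq_sum_forests:
  assumes V: "finite V" and \<pi>: "partition_on V \<pi>"
  shows "elem \<pi> \<kappa> = (\<Sum>g\<in>forests V \<pi>. forest_sign V g * agree (forest_edges V g) \<kappa>)"
proof -
  define P where "P j = {i. i \<le> j \<and> (i, j) \<in> same_block \<pi>}" for j
  define F where "F j i = (if i = j then 1 else - of_bool (\<kappa> i = \<kappa> j) :: rat)" for j i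
  have finP: "finite (P j)" for j by (auto simp: P_def intro: finite_subset[of _ "{..j}"])
  have F: "(\<Sum>i\<in>P j. F j i) = 1 - of_nat (card {i. i < j \<and> (i, j) \<in> same_block \<pi> \<and> \<kappa> i = \<kappa> j})"
    if "j \<in> V" for j
  proof -
    have "P j = insert j {i. i < j \<and> (i, j) \<in> same_block \<pi>}"
      using same_block_refl[OF \<pi> that] by (auto simp: P_def)
    then have "(\<Sum>i\<in>P j. F j i) = 1 + (\<Sum>i | i < j \<and> (i, j) \<in> same_block \<pi>. F j i)"
      using finP[of j] by (simp add: F_def)
    also have "(\<Sum>i | i < j \<and> (i, j) \<in> same_block \<pi>. F j i)
        = (\<Sum>i | i < j \<and> (i, j) \<in> same_block \<pi>. - of_bool (\<kappa> i = \<kappa> j))"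
      by (intro sum.cong) (auto simp: F_def)
    also have "\<dots> = - of_nat (card {i. i < j \<and> (i, j) \<in> same_block \<pi> \<and> \<kappa> i = \<kappa> j})"
      by (simp add: sum_negf Int_def conj_assoc)
    finally show ?thesis by simp
  qed
  have "(\<Sum>g\<in>forests V \<pi>. forest_sign V g * agree (forest_edges V g) \<kappa>)
      = (\<Sum>g\<in>PiE V P. \<Prod>j\<in>V. F j (g j))"
  proof (intro sum.cong)
    fix g
    have "agree (forest_edges V g) \<kappa> = (\<Prod>j\<in>V. of_bool (\<kappa> (g j) = \<kappa> j))"
      using agree_Union_prod[OF V, of "\<lambda>j. {(g j, j)}" \<kappa>]
      by (simp add: forest_edges_def agree_def UNION_singleton_eq_range)
    then show "forest_sign V g * agree (forest_edges V g) \<kappa> = (\<Prod>j\<in>V. F j (g j))"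
      by (simp add: forest_sign_def F_def flip: prod.distrib) (auto intro!: prod.cong)
  qed (auto simp: forests_def P_def)
  \<comment> \<open>Distributivity: choosing a parent for every vertex independently expands the
    product of sums.\<close>
  also have "\<dots> = (\<Prod>j\<in>V. \<Sum>i\<in>P j. F j i)"
    by (rule prod_sum_PiE[symmetric]) (use V finP in auto)
  also have "\<dots> = elem \<pi> \<kappa>"
  proof (cases "\<exists>i j. i < j \<and> (i, j) \<in> same_block \<pi> \<and> \<kappa> i = \<kappa> j")
    case False
    then have "{i. i < j \<and> (i, j) \<in> same_block \<pi> \<and> \<kappa> i = \<kappa> j} = {}" for j by blast
    then have "(\<Prod>j\<in>V. \<Sum>i\<in>P j. F j i) = 1" by (intro prod.neutral) (simp add: F)
    moreover have "\<kappa> a \<noteq> \<kappa> b" if "(a, b) \<in> same_block \<pi>" "a \<noteq> b" for a b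
      using that False same_block_sym[OF that(1)] by (metis linorder_neqE_nat)
    ultimately show ?thesis by (auto simp: elem_def)
  next
    case True
    define j where "j = (LEAST j. \<exists>i<j. (i, j) \<in> same_block \<pi> \<and> \<kappa> i = \<kappa> j)"
    have "\<exists>i<j. (i, j) \<in> same_block \<pi> \<and> \<kappa> i = \<kappa> j"
      unfolding j_def by (rule LeastI_ex) (use True in blast)
    then obtain i where i: "i < j" "(i, j) \<in> same_block \<pi>" "\<kappa> i = \<kappa> j" by blast
    have min: "\<not> (\<exists>i<k. (i, k) \<in> same_block \<pi> \<and> \<kappa> i = \<kappa> k)" if "k < j" for k
      using that not_less_Least unfolding j_def by blast
    \<comment> \<open>Two different elements of the block before \<open>j\<close> with the colour of
      \<open>j\<close> would already form a repetition before \<open>j\<close>.\<close>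
    have "k = i" if "k < j" "(k, j) \<in> same_block \<pi>" "\<kappa> k = \<kappa> j" for k
    proof -
      have "(i, k) \<in> same_block \<pi>" "(k, i) \<in> same_block \<pi>"
        using that i \<pi> by (meson same_block_sym same_block_trans)+
      then show ?thesis
        using min[of i] min[of k] that i by (metis linorder_neqE_nat)
    qed
    then have "{i. i < j \<and> (i, j) \<in> same_block \<pi> \<and> \<kappa> i = \<kappa> j} = {i}"
      using i by blast
    moreover have "j \<in> V" using i same_block_subset[OF \<pi>] by blast
    ultimately have "(\<Prod>j\<in>V. \<Sum>i\<in>P j. F j i) = 0"
      by (intro prod_zero[OF V] bexI[of _ j]) (simp_all add: F)
    moreover have "elem \<pi> \<kappa> = 0" using i by (auto simp: elem_def intro!: bexI[of _ "(i, j)"])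
    ultimately show ?thesis by simp
  qed
  finally show ?thesis by simp
qed

text \<open>A block contributes 1 at its minimum and -1 at every other element, so for a partition
  \<open>\<tau>\<close> of a finite \<open>V\<close> this is -1 to the power
  \<open>card V - card \<tau>\<close>.\<close>

definition block_sign :: "nat set \<Rightarrow> nat set set \<Rightarrow> rat" where
  "block_sign V \<tau> = (\<Prod>j\<in>V. if \<forall>i. (i, j) \<in> same_block \<tau> \<longrightarrow> j \<le> i then 1 else -1)"

lemma block_sign_square: "finite V \<Longrightarrow> block_sign V \<tau> * block_sign V \<tau> = 1"
  unfolding block_sign_def by (simp flip: prod.distrib) (intro prod.neutral, auto)

text \<open>The roots of an increasing forest are the minima of its components.\<close>

lemma forest_sign_eq:
  assumes g: "g \<in> forests V \<pi>" and \<pi>: "partition_on V \<pi>"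
  shows "forest_sign V g = block_sign V (components V (forest_edges V g))"
proof -
  let ?\<tau> = "components V (forest_edges V g)"
  have sub: "forest_edges V g \<subseteq> V \<times> V"
    using forest_edges_subset[OF g] same_block_subset[OF \<pi>] by blast
  have "g j = j \<longleftrightarrow> (\<forall>i. (i, j) \<in> same_block ?\<tau> \<longrightarrow> j \<le> i)" if j: "j \<in> V" for j
  proof
    assume root: "g j = j"
    \<comment> \<open>\<open>D\<close> collects the vertices whose iterated parents reach the root
      \<open>j\<close>. It is closed under forest edges in both directions, so it contains the
      component of \<open>j\<close>; since parents never exceed their children, \<open>j\<close> is
      the minimum there.\<close>
    define D where "D = {k. \<exists>n. (g ^^ n) k = j}"
    have D: "k \<in> D \<longleftrightarrow> g k \<in> D" for k
    proof
      assume "k \<in> D"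
      then obtain n where n: "(g ^^ n) k = j" by (auto simp: D_def)
      then show "g k \<in> D"
      proof (cases n)
        case 0
        then show ?thesis using n root by (auto simp: D_def intro: exI[of _ 0])
      next
        case (Suc m)
        then show ?thesis using n by (auto simp: D_def funpow_swap1)
      qed
    next
      assume "g k \<in> D"
      then obtain n where "(g ^^ n) (g k) = j" by (auto simp: D_def)
      then have "(g ^^ Suc n) k = j" by (simp add: funpow_swap1)
      then show "k \<in> D" unfolding D_def by blast
    qed
    have le: "j \<le> k" if "k \<in> V" "(g ^^ n) k = j" for n k
      using that
    proof (induction n arbitrary: k)
      case (Suc n)
      have "g k \<in> V" using sub Suc.prems by (auto simp: forest_edges_def)
      with Suc have "j \<le> g k" by (simp add: funpow_swap1)
      also have "g k \<le> k" using forestsD[OF g] Suc.prems by auto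
      finally show ?case .
    qed auto
    have "a \<in> D" if "(a, j) \<in> (forest_edges V g \<union> (forest_edges V g)\<inverse>)\<^sup>*" for a
      using that
    proof (induction rule: converse_rtrancl_induct)
      case base
      show ?case by (auto simp: D_def intro: exI[of _ 0])
    next
      case (step y z)
      then show ?case using D by (auto simp: forest_edges_def)
    qed
    then show "\<forall>i. (i, j) \<in> same_block ?\<tau> \<longrightarrow> j \<le> i"
      using le by (auto simp: same_block_components D_def)
  next
    assume "\<forall>i. (i, j) \<in> same_block ?\<tau> \<longrightarrow> j \<le> i"
    moreover have "(g j, j) \<in> same_block ?\<tau>"
      using subset_same_block_components[OF sub] j by (auto simp: forest_edges_def)
    ultimately show "g j = j" using forestsD[OF g j] by force
  qed
  then show ?thesis unfolding forest_sign_def block_sign_def by (intro prod.cong) auto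
qed

text \<open>For \<open>\<tau>\<close> refining \<open>\<pi>\<close> this is the Moebius function of
  the partition lattice between the discrete partition and \<open>\<tau>\<close>. Writing it as a
  signed count makes it visible that the sign depends on \<open>\<tau>\<close> alone.\<close>

definition elem_coeff :: "nat set \<Rightarrow> nat set set \<Rightarrow> nat set set \<Rightarrow> rat" where
  "elem_coeff V \<pi> \<tau> =
     block_sign V \<tau> * of_nat (card {g\<in>forests V \<pi>. components V (forest_edges V g) = \<tau>})"

text \<open>The forests are grouped by their component partition, on which both the sign and the
  agreement indicator of a forest depend.\<close>

lemma elem_eq_sum_agree:
  assumes V: "finite V" and \<pi>: "partition_on V \<pi>"
  shows "elem \<pi> \<kappa> = (\<Sum>\<tau>\<in>parts V. elem_coeff V \<pi> \<tau> * agree (same_block \<tau>) \<kappa>)"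
proof -
  let ?t = "\<lambda>g. forest_sign V g * agree (forest_edges V g) \<kappa>"
  let ?c = "\<lambda>g. components V (forest_edges V g)"
  have "elem \<pi> \<kappa> = (\<Sum>\<tau>\<in>parts V. \<Sum>g\<in>{g\<in>forests V \<pi>. ?c g = \<tau>}. ?t g)"
    unfolding elem_eq_sum_forests[OF assms]
    by (rule sum.group[symmetric]) (use V in \<open>auto simp: finite_forests finite_parts\<close>)
  also have "\<dots> = (\<Sum>\<tau>\<in>parts V. elem_coeff V \<pi> \<tau> * agree (same_block \<tau>) \<kappa>)"
  proof (intro sum.cong refl)
    fix \<tau> assume "\<tau> \<in> parts V"
    have "?t g = block_sign V \<tau> * agree (same_block \<tau>) \<kappa>"
      if "g \<in> forests V \<pi>" "?c g = \<tau>" for g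
    proof -
      have "forest_edges V g \<subseteq> V \<times> V"
        using forest_edges_subset[OF that(1)] same_block_subset[OF \<pi>] by blast
      then show ?thesis
        using forest_sign_eq[OF that(1) \<pi>] agree_components[of "forest_edges V g" V] that by simp
    qed
    then show "(\<Sum>g\<in>{g\<in>forests V \<pi>. ?c g = \<tau>}. ?t g)
        = elem_coeff V \<pi> \<tau> * agree (same_block \<tau>) \<kappa>"
      by (simp add: elem_coeff_def)
  qed
  finally show ?thesis .
qed

lemma elem_coeff_nonzeroD:
  assumes "partition_on V \<pi>" "elem_coeff V \<pi> \<tau> \<noteq> 0"
  shows "same_block \<tau> \<subseteq> same_block \<pi>"
proof -
  from assms(2) have "{g\<in>forests V \<pi>. components V (forest_edges V g) = \<tau>} \<noteq> {}"
    unfolding elem_coeff_def by (metis card.empty mult_zero_right of_nat_0)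
  then obtain g where "g \<in> forests V \<pi>" "components V (forest_edges V g) = \<tau>"
    by blast
  then show ?thesis
    using same_block_components_le[OF assms(1) forest_edges_subset] by blast
qed

text \<open>After the sign is cancelled a count of forests remains, so one forest with components
  \<open>\<tau>\<close> suffices.\<close>

lemma elem_coeff_pos:
  assumes V: "finite V" and \<pi>: "partition_on V \<pi>" and \<tau>: "partition_on V \<tau>"
    and le: "same_block \<tau> \<subseteq> same_block \<pi>"
  shows "block_sign V \<tau> * elem_coeff V \<pi> \<tau> > 0"
proof -
  \<comment> \<open>The star forest: every vertex hangs from the least element of its block of
    \<open>\<tau>\<close>.\<close>
  define g where "g = (\<lambda>j\<in>V. LEAST i. (i, j) \<in> same_block \<tau>)"
  have gj: "g j \<le> j" "(g j, j) \<in> same_block \<tau>" if "j \<in> V" for j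
    using that same_block_refl[OF \<tau> that] by (auto simp: g_def intro: Least_le LeastI)
  have g: "g \<in> forests V \<pi>"
    unfolding forests_def using gj le by (intro PiE_I) (auto simp: g_def)
  have edges: "forest_edges V g \<subseteq> same_block \<tau>" using gj by (auto simp: forest_edges_def)
  have "components V (forest_edges V g) = \<tau>"
  proof (rule same_block_eqD[OF components_parts \<tau>], rule subset_antisym)
    show "same_block (components V (forest_edges V g)) \<subseteq> same_block \<tau>"
      by (rule same_block_components_le[OF \<tau> edges])
    show "same_block \<tau> \<subseteq> same_block (components V (forest_edges V g))"
    proof clarify
      fix a b assume ab: "(a, b) \<in> same_block \<tau>"
      then have in_V: "a \<in> V" "b \<in> V" using same_block_subset[OF \<tau>] by auto
      have "(i, a) \<in> same_block \<tau> \<longleftrightarrow> (i, b) \<in> same_block \<tau>" for i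
        using ab \<tau> by (metis same_block_sym same_block_trans)
      then have "g a = g b" using in_V by (simp add: g_def)
      moreover have "(g j, j) \<in> same_block (components V (forest_edges V g))" if "j \<in> V" for j
        using subset_same_block_components[of "forest_edges V g" V] that edges
          same_block_subset[OF \<tau>] by (auto simp: forest_edges_def)
      ultimately show "(a, b) \<in> same_block (components V (forest_edges V g))"
        using in_V by (metis components_parts same_block_sym same_block_trans)
    qed
  qed
  with g have "card {g\<in>forests V \<pi>. components V (forest_edges V g) = \<tau>} > 0"
    using finite_forests[OF V] by (auto simp: card_gt_0_iff)
  then show ?thesis
    using block_sign_square[OF V] by (simp add: elem_coeff_def flip: mult.assoc)
qed

section \<open>Linear independence of the elementary functions\<close>

text \<open>Triangularity: for a \<open>\<pi>\<close> with nonzero coefficient and the most related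
  pairs, the power sum of \<open>\<pi>\<close> occurs in no other elementary function of the
  combination.\<close>

lemma elem_independent:
  fixes V :: "nat set"
  assumes V: "finite V" and zero: "\<And>\<kappa>. (\<Sum>\<pi>\<in>parts V. c \<pi> * elem \<pi> \<kappa>) = 0"
    and "partition_on V \<pi>"
  shows "c \<pi> = 0"
proof (rule ccontr)
  assume c: "c \<pi> \<noteq> 0"
  let ?M = "{\<pi>\<in>parts V. c \<pi> \<noteq> 0}"
  have "finite ?M" "?M \<noteq> {}" using finite_parts[OF V] assms(3) c by auto
  then have "Max ((\<lambda>\<pi>. card (same_block \<pi>)) ` ?M) \<in> (\<lambda>\<pi>. card (same_block \<pi>)) ` ?M"
    by (intro Max_in) auto
  then obtain \<pi> where Max: "Max ((\<lambda>\<pi>. card (same_block \<pi>)) ` ?M) = card (same_block \<pi>)"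
    and \<pi>: "\<pi> \<in> ?M"
    by (rule imageE)
  have max: "card (same_block \<sigma>) \<le> card (same_block \<pi>)" if "\<sigma> \<in> ?M" for \<sigma>
    unfolding Max[symmetric] using \<open>finite ?M\<close> that by (intro Max_ge) auto
  \<comment> \<open>\<open>a \<tau>\<close> is the coefficient of the power sum of
    \<open>\<tau>\<close> in the whole combination.\<close>
  define a where "a \<tau> = (\<Sum>\<sigma>\<in>parts V. c \<sigma> * elem_coeff V \<sigma> \<tau>)" for \<tau>
  have sum_a: "(\<Sum>\<tau>\<in>parts V. a \<tau> * agree (same_block \<tau>) \<kappa>) = (\<Sum>\<sigma>\<in>parts V. c \<sigma> * elem \<sigma> \<kappa>)" for \<kappa>
    unfolding a_def sum_distrib_right
    by (subst sum.swap) (auto intro!: sum.cong simp: elem_eq_sum_agree[OF V] sum_distrib_left mult.assoc)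
  have eq: "c \<sigma> * elem_coeff V \<sigma> \<pi> = (if \<sigma> = \<pi> then c \<pi> * elem_coeff V \<pi> \<pi> else 0)"
    if \<sigma>: "\<sigma> \<in> parts V" for \<sigma>
  proof (cases "c \<sigma> * elem_coeff V \<sigma> \<pi> = 0")
    case False
    then have "same_block \<pi> \<subseteq> same_block \<sigma>" using elem_coeff_nonzeroD \<sigma> by auto
    moreover have "card (same_block \<sigma>) \<le> card (same_block \<pi>)" using False \<sigma> max by auto
    ultimately have "same_block \<pi> = same_block \<sigma>"
      using card_seteq finite_same_block[OF V] \<sigma> by blast
    then have "\<sigma> = \<pi>" using same_block_eqD \<sigma> \<pi> by blast
    then show ?thesis by simp
  qed auto
  have "a \<pi> = (\<Sum>\<sigma>\<in>parts V. if \<sigma> = \<pi> then c \<pi> * elem_coeff V \<pi> \<pi> else 0)"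
    unfolding a_def by (rule sum.cong[OF refl eq])
  then have "a \<pi> = c \<pi> * elem_coeff V \<pi> \<pi>"
    using \<pi> finite_parts[OF V] by (simp add: sum.delta)
  moreover have "a \<pi> = 0" using agree_same_block_independent[OF V, of a \<pi>] zero sum_a \<pi> by auto
  moreover have "elem_coeff V \<pi> \<pi> \<noteq> 0" using elem_coeff_pos[OF V, of \<pi> \<pi>] \<pi> by auto
  ultimately show False using \<pi> by auto
qed

section \<open>Expansions and type sums\<close>

text \<open>The coefficients form a total function, of which only the values on partitions of
  \<open>V\<close> matter; uniqueness is therefore stated pointwise on these.\<close>

definition elem_expansion :: "nat set \<Rightarrow> ((nat \<Rightarrow> nat) \<Rightarrow> rat) \<Rightarrow> (nat set set \<Rightarrow> rat) \<Rightarrow> bool" where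
  "elem_expansion V f c \<longleftrightarrow> (\<forall>\<kappa>. f \<kappa> = (\<Sum>\<pi>\<in>parts V. c \<pi> * elem \<pi> \<kappa>))"

lemma elem_expansion_unique:
  assumes "finite V" "elem_expansion V f c" "elem_expansion V f c'" "partition_on V \<pi>"
  shows "c \<pi> = c' \<pi>"
proof -
  have "(\<Sum>\<pi>\<in>parts V. (c \<pi> - c' \<pi>) * elem \<pi> \<kappa>) = 0" for \<kappa>
    using assms(2,3) unfolding elem_expansion_def by (simp add: left_diff_distrib sum_subtractf)
  then show ?thesis using elem_independent[OF assms(1), of "\<lambda>\<pi>. c \<pi> - c' \<pi>" \<pi>] assms(4) by simp
qed

lemma elem_expansion_elem:
  "finite V \<Longrightarrow> partition_on V \<pi> \<Longrightarrow> elem_expansion V (elem \<pi>) (\<lambda>\<sigma>. of_bool (\<sigma> = \<pi>))"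
  unfolding elem_expansion_def by (simp add: finite_parts Collect_conv_if)

lemma elem_expansion_diff:
  "elem_expansion V f c \<Longrightarrow> elem_expansion V g d \<Longrightarrow>
    elem_expansion V (\<lambda>\<kappa>. f \<kappa> - g \<kappa>) (\<lambda>\<pi>. c \<pi> - d \<pi>)"
  unfolding elem_expansion_def by (simp add: left_diff_distrib sum_subtractf)

lemma elem_expansion_scale:
  "elem_expansion V f c \<Longrightarrow> elem_expansion V (\<lambda>\<kappa>. a * f \<kappa>) (\<lambda>\<pi>. a * c \<pi>)"
  unfolding elem_expansion_def by (simp add: sum_distrib_left mult.assoc)

lemma elem_expansion_sum:
  assumes "\<And>i. i \<in> I \<Longrightarrow> elem_expansion V (f i) (c i)"
  shows "elem_expansion V (\<lambda>\<kappa>. \<Sum>i\<in>I. f i \<kappa>) (\<lambda>\<pi>. \<Sum>i\<in>I. c i \<pi>)"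
  unfolding elem_expansion_def sum_distrib_right
  by (subst sum.swap) (use assms in \<open>auto simp: elem_expansion_def\<close>)

text \<open>Asking for expansions only where \<open>a i \<noteq> 0\<close> lets the induction in
  \<open>ex_elem_expansion_agree\<close> restrict itself to strict refinements.\<close>

lemma ex_elem_expansion_sum:
  assumes "\<And>i. i \<in> I \<Longrightarrow> a i \<noteq> 0 \<Longrightarrow> \<exists>c. elem_expansion V (f i) c"
  shows "\<exists>c. elem_expansion V (\<lambda>\<kappa>. \<Sum>i\<in>I. a i * f i \<kappa>) c"
proof -
  have "\<exists>c. elem_expansion V (\<lambda>\<kappa>. a i * f i \<kappa>) c" if i: "i \<in> I" for i
  proof (cases "a i = 0")
    case True
    then show ?thesis by (intro exI[of _ "\<lambda>_. 0"]) (simp add: elem_expansion_def)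
  next
    case False
    then show ?thesis using assms i elem_expansion_scale by blast
  qed
  then obtain c where "\<And>i. i \<in> I \<Longrightarrow> elem_expansion V (\<lambda>\<kappa>. a i * f i \<kappa>) (c i)" by metis
  then show ?thesis by (intro exI) (rule elem_expansion_sum)
qed

text \<open>Triangular inversion: \<open>elem \<pi>\<close> is a nonzero multiple of the power sum
  of \<open>\<pi>\<close> plus power sums of strictly finer partitions. These have fewer related
  pairs, so induction applies and the equation can be solved for the power sum of
  \<open>\<pi>\<close>.\<close>

lemma ex_elem_expansion_agree:
  assumes V: "finite V"
  shows "R \<subseteq> V \<times> V \<Longrightarrow> \<exists>c. elem_expansion V (agree R) c"
proof (induction "card (same_block (components V R))" arbitrary: R rule: less_induct)
  case less
  define \<pi> where "\<pi> = components V R"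
  have \<pi>: "partition_on V \<pi>" by (auto simp: \<pi>_def)
  define m where "m = elem_coeff V \<pi>"
  have "m \<pi> \<noteq> 0" using elem_coeff_pos[OF V \<pi> \<pi>] by (auto simp: m_def)
  have "\<exists>c. elem_expansion V (agree (same_block \<tau>)) c" if \<tau>: "\<tau> \<in> parts V - {\<pi>}" "m \<tau> \<noteq> 0" for \<tau>
  proof (rule less.hyps)
    have "same_block \<tau> \<subset> same_block \<pi>"
      using elem_coeff_nonzeroD[OF \<pi>, of \<tau>] \<tau> same_block_eqD[OF _ \<pi>, of \<tau>] by (auto simp: m_def)
    then show "card (same_block (components V (same_block \<tau>))) < card (same_block (components V R))"
      using \<tau> by (simp add: components_same_block psubset_card_mono finite_same_block[OF V \<pi>] flip: \<pi>_def)
    show "same_block \<tau> \<subseteq> V \<times> V" using \<tau> by (simp add: same_block_subset)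
  qed
  then obtain c where "elem_expansion V (\<lambda>\<kappa>. \<Sum>\<tau>\<in>parts V - {\<pi>}. m \<tau> * agree (same_block \<tau>) \<kappa>) c"
    using ex_elem_expansion_sum[of "parts V - {\<pi>}" m V "\<lambda>\<tau>. agree (same_block \<tau>)"] by blast
  then have "\<exists>c. elem_expansion V
      (\<lambda>\<kappa>. 1 / m \<pi> * (elem \<pi> \<kappa> - (\<Sum>\<tau>\<in>parts V - {\<pi>}. m \<tau> * agree (same_block \<tau>) \<kappa>))) c"
    using elem_expansion_scale[OF elem_expansion_diff[OF elem_expansion_elem[OF V \<pi>]]] by blast
  also have "(\<lambda>\<kappa>. 1 / m \<pi> * (elem \<pi> \<kappa> - (\<Sum>\<tau>\<in>parts V - {\<pi>}. m \<tau> * agree (same_block \<tau>) \<kappa>)))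
      = agree (same_block \<pi>)"
    using \<open>m \<pi> \<noteq> 0\<close> \<pi> finite_parts[OF V]
    by (simp add: fun_eq_iff elem_eq_sum_agree[OF V \<pi>] sum.remove[of "parts V" \<pi>] flip: m_def)
  also have "\<dots> = agree R" unfolding \<pi>_def by (rule agree_components[OF less.prems])
  finally show ?case .
qed

text \<open>Writing \<open>elem \<pi>\<close> in power sums over \<open>V\<close> turns the product
  into a combination of agreement functions over \<open>V'\<close>.\<close>

lemma ex_elem_expansion_elem_agree:
  assumes "finite V" "finite V'" "V \<subseteq> V'" "R \<subseteq> V' \<times> V'" "partition_on V \<pi>"
  shows "\<exists>c. elem_expansion V' (\<lambda>\<kappa>. elem \<pi> \<kappa> * agree R \<kappa>) c"
proof -
  have "\<exists>c. elem_expansion V' (\<lambda>\<kappa>. \<Sum>\<tau>\<in>parts V. elem_coeff V \<pi> \<tau> * agree (same_block \<tau> \<union> R) \<kappa>) c"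
  proof (rule ex_elem_expansion_sum, rule ex_elem_expansion_agree[OF assms(2)])
    fix \<tau> assume "\<tau> \<in> parts V"
    then have "same_block \<tau> \<subseteq> V \<times> V" by (simp add: same_block_subset)
    then show "same_block \<tau> \<union> R \<subseteq> V' \<times> V'" using assms(3,4) by blast
  qed
  then show ?thesis
    by (simp add: elem_eq_sum_agree[OF assms(1,5)] sum_distrib_right mult.assoc agree_mult)
qed

section \<open>Type sums and their invariance under relabelling\<close>

text \<open>The coefficient at \<open>t\<close> after applying \<nu>, with an arbitrary
  distinguished vertex \<open>r\<close> in place of the largest label.\<close>

definition type_sum :: "nat set \<Rightarrow> nat \<Rightarrow> (nat set set \<Rightarrow> rat) \<Rightarrow> nat multiset \<times> nat \<Rightarrow> rat" where
  "type_sum V r c t = (\<Sum>\<pi> | partition_on V \<pi> \<and> partition_type r \<pi> = t. c \<pi>)"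

lemma block_eqI: "partition_on V \<pi> \<Longrightarrow> B \<in> \<pi> \<Longrightarrow> i \<in> B \<Longrightarrow> block \<pi> i = B"
  unfolding block_def
  by (rule the_equality) (auto simp: partition_on_def disjoint_def)

lemma block_in: "partition_on V \<pi> \<Longrightarrow> i \<in> V \<Longrightarrow> block \<pi> i \<in> \<pi> \<and> i \<in> block \<pi> i"
  using block_eqI partition_onD1 by (metis UnionE)

lemma type_sum_cong:
  "(\<And>\<pi>. partition_on V \<pi> \<Longrightarrow> c \<pi> = d \<pi>) \<Longrightarrow> type_sum V r c t = type_sum V r d t"
  unfolding type_sum_def by (rule sum.cong) auto

lemma type_sum_unique:
  "finite V \<Longrightarrow> elem_expansion V f c \<Longrightarrow> elem_expansion V f d \<Longrightarrow> type_sum V r c t = type_sum V r d t"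
  by (intro type_sum_cong elem_expansion_unique)

lemma type_sum_of_bool:
  "finite V \<Longrightarrow> partition_on V \<pi> \<Longrightarrow>
    type_sum V r (\<lambda>\<sigma>. of_bool (\<sigma> = \<pi>)) t = of_bool (t = partition_type r \<pi>)"
proof -
  assume V: "finite V" and \<pi>: "partition_on V \<pi>"
  have "type_sum V r (\<lambda>\<sigma>. of_bool (\<sigma> = \<pi>)) t
      = (\<Sum>\<sigma> | partition_on V \<sigma> \<and> partition_type r \<sigma> = t. if \<sigma> = \<pi> then 1 else 0)"
    unfolding type_sum_def by (intro sum.cong) auto
  also have "\<dots> = of_bool (t = partition_type r \<pi>)"
    using \<pi> finite_subset[OF _ finite_parts[OF V], of "{\<sigma>. partition_on V \<sigma> \<and> partition_type r \<sigma> = t}"]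
    by (subst sum.delta) auto
  finally show ?thesis .
qed

lemma type_sum_diff: "type_sum V r (\<lambda>\<pi>. c \<pi> - d \<pi>) t = type_sum V r c t - type_sum V r d t"
  by (simp add: type_sum_def sum_subtractf)

lemma type_sum_sum: "type_sum V r (\<lambda>\<pi>. \<Sum>i\<in>I. c i \<pi>) t = (\<Sum>i\<in>I. type_sum V r (c i) t)"
  unfolding type_sum_def by (rule sum.swap)

lemma type_sum_scale: "type_sum V r (\<lambda>\<pi>. a * c \<pi>) t = a * type_sum V r c t"
  by (simp add: type_sum_def sum_distrib_left)

abbreviation relabel :: "(nat \<Rightarrow> nat) \<Rightarrow> nat set set \<Rightarrow> nat set set" where
  "relabel s \<equiv> (`) ((`) s)"

lemma elem_relabel: "bij s \<Longrightarrow> elem \<pi> (\<kappa> \<circ> s) = elem (relabel s \<pi>) \<kappa>"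
proof -
  assume s: "bij s"
  have "same_block (relabel s \<pi>) = map_prod s s ` same_block \<pi>"
    by (force simp: same_block_def)
  then show ?thesis using bij_is_inj[OF s] by (auto simp: elem_def inj_eq)
qed

lemma partition_on_relabel:
  assumes "bij s" "s ` V = V" "partition_on V \<pi>"
  shows "partition_on V (relabel s \<pi>)"
proof -
  have "partition_on (s ` V) (relabel s \<pi> - {{}})"
    using assms(1) by (intro partition_on_inj_image[OF assms(3)] inj_on_subset[OF bij_is_inj]) auto
  moreover have "{} \<notin> relabel s \<pi>" using partition_onD3[OF assms(3)] by auto
  ultimately show ?thesis using assms(2) by simp
qed

lemma partition_type_relabel:
  assumes "bij s" "s ` V = V" "partition_on V \<pi>" "s r = r" "r \<in> V"
  shows "partition_type r (relabel s \<pi>) = partition_type r \<pi>"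
proof -
  have inj: "inj s" using assms(1) by (rule bij_is_inj)
  note r = block_in[OF assms(3,5)]
  have block: "block (relabel s \<pi>) r = s ` block \<pi> r"
    using r assms(4) by (intro block_eqI[OF partition_on_relabel[OF assms(1-3)]]) (force, metis imageI)
  have inj': "inj ((`) s)" using inj by (auto intro!: injI simp: inj_image_eq_iff)
  have "relabel s \<pi> - {s ` block \<pi> r} = relabel s (\<pi> - {block \<pi> r})"
    using image_set_diff[OF inj', of \<pi> "{block \<pi> r}"] by simp
  then have "mset_set (relabel s \<pi> - {s ` block \<pi> r}) = image_mset ((`) s) (mset_set (\<pi> - {block \<pi> r}))"
    using inj' by (simp add: image_mset_mset_set inj_on_subset)
  moreover have "card (s ` B) = card B" for B
    using inj by (simp add: card_image inj_on_subset)
  ultimately show ?thesis unfolding partition_type_def block by (simp add: multiset.map_comp o_def)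
qed

text \<open>A permutation fixing \<open>r\<close> permutes the coefficients of the expansion and
  preserves types. As \<open>s\<close> is an involution, it serves as its own inverse when the sums
  are reindexed.\<close>

lemma type_sum_relabel:
  assumes V: "finite V" and s: "\<And>i. s (s i) = i" "s ` V = V" "s r = r" "r \<in> V"
    and f: "elem_expansion V f c" and g: "elem_expansion V g d" and fg: "\<And>\<kappa>. g \<kappa> = f (\<kappa> \<circ> s)"
  shows "type_sum V r d t = type_sum V r c t"
proof -
  have bij: "bij s" using s(1) by (intro o_bij[of s]) auto
  have rr: "relabel s (relabel s \<pi>) = \<pi>" for \<pi> by (auto simp: image_comp o_def s(1))
  have parts: "relabel s \<pi> \<in> parts V" if "\<pi> \<in> parts V" for \<pi>
    using that partition_on_relabel[OF bij s(2)] by simp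
  have "elem_expansion V g (\<lambda>\<pi>. c (relabel s \<pi>))"
    unfolding elem_expansion_def
  proof
    fix \<kappa>
    have "g \<kappa> = (\<Sum>\<pi>\<in>parts V. c \<pi> * elem (relabel s \<pi>) \<kappa>)"
      using f by (simp add: fg elem_expansion_def elem_relabel[OF bij])
    also have "\<dots> = (\<Sum>\<pi>\<in>parts V. c (relabel s \<pi>) * elem \<pi> \<kappa>)"
      by (rule sum.reindex_bij_witness[of _ "relabel s" "relabel s"]) (auto simp only: rr parts)
    finally show "g \<kappa> = (\<Sum>\<pi>\<in>parts V. c (relabel s \<pi>) * elem \<pi> \<kappa>)" .
  qed
  then have "type_sum V r d t = type_sum V r (\<lambda>\<pi>. c (relabel s \<pi>)) t"
    by (rule type_sum_unique[OF V g])
  also have "\<dots> = type_sum V r c t"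
    unfolding type_sum_def
    by (rule sum.reindex_bij_witness[of _ "relabel s" "relabel s"])
      (use parts partition_type_relabel[OF bij s(2) _ s(3,4)] in \<open>auto simp: rr\<close>)
  finally show ?thesis .
qed

section \<open>Appending a vertex to the end of a path\<close>

definition extend_weight :: "nat multiset \<times> nat \<Rightarrow> nat multiset \<times> nat \<Rightarrow> rat" where
  "extend_weight s t = (case s of (\<mu>, b) \<Rightarrow>
     (1 - 1 / of_nat b) * of_bool (t = (add_mset b \<mu>, 1)) + 1 / of_nat b * of_bool (t = (\<mu>, b + 1)))"

lemma extend_weight_nonneg: "extend_weight s t \<ge> 0"
proof -
  obtain \<mu> b where s: "s = (\<mu>, b)" by fastforce
  \<comment> \<open>For \<open>b = 0\<close>, which is not the size of a block,
    \<open>1 / 0 = 0\<close> makes the two weights 1 and 0.\<close>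
  show ?thesis by (cases "b = 0") (auto simp: extend_weight_def s field_simps)
qed

text \<open>The difference of \<open>e\<^bsub>\<pi>/y\<^esub>\<close> (the vertex \<open>y\<close> added as a singleton) and
  \<open>e\<^bsub>\<pi>+y\<^esub>\<close> (\<open>y\<close> added to the block \<open>B\<close> of \<open>x\<close>) counts the colourings of
  \<open>e\<^sub>\<pi>\<close> in which \<open>y\<close> has the colour of some \<open>j \<in> B\<close>. The \<open>b\<close> summands for the
  different \<open>j\<close> are carried into each other by transpositions fixing \<open>y\<close>, so each of them
  has type sums \<open>1 / b\<close> times those of the difference.\<close>

lemma elem_extend_type_sum:
  assumes V: "finite V" and \<pi>: "partition_on V \<pi>" and x: "x \<in> V" and y: "y \<notin> V"
  obtains q where "elem_expansion (insert y V) (\<lambda>\<kappa>. elem \<pi> \<kappa> * (1 - agree {(x, y)} \<kappa>)) q"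
    "\<And>t. type_sum (insert y V) y q t = extend_weight (partition_type x \<pi>) t"
proof -
  define W where "W = insert y V"
  define B where "B = block \<pi> x"
  define \<pi>\<^sub>1 where "\<pi>\<^sub>1 = insert {y} \<pi>"
  define \<pi>\<^sub>2 where "\<pi>\<^sub>2 = insert (insert y B) (\<pi> - {B})"
  have W: "finite W" "y \<in> W" using V by (auto simp: W_def)
  have B: "B \<in> \<pi>" "x \<in> B" using block_in[OF \<pi> x] by (auto simp: B_def)
  have BV: "B \<subseteq> V" using B partition_onD1[OF \<pi>] by auto
  have finB: "finite B" using BV V finite_subset by blast
  have cardB: "card B > 0" using finB B by (auto simp: card_gt_0_iff)
  have y_notin: "y \<notin> C" if "C \<in> \<pi>" for C using that y partition_onD1[OF \<pi>] by auto
  have \<pi>1: "partition_on W \<pi>\<^sub>1"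
    unfolding W_def \<pi>\<^sub>1_def using \<pi> y y_notin by (subst partition_on_insert) (auto simp: disjnt_def)
  have \<pi>B: "partition_on (V - B) (\<pi> - {B})"
    using partition_on_insert[of B "\<pi> - {B}" V] B \<pi>
    by (auto simp: insert_absorb disjnt_def dest: partition_onD2 disjointD)
  have "insert y V - insert y B = V - B" using y by auto
  then have \<pi>2: "partition_on W \<pi>\<^sub>2"
    unfolding W_def \<pi>\<^sub>2_def using \<pi>B BV y_notin B \<pi>
    by (subst partition_on_insert) (auto simp: disjnt_def partition_on_def disjoint_def)
  have elem1: "elem \<pi>\<^sub>1 \<kappa> = elem \<pi> \<kappa>" for \<kappa>
    unfolding elem_def \<pi>\<^sub>1_def same_block_def by (intro arg_cong[of _ _ of_bool]) auto
  have same2: "same_block \<pi>\<^sub>2 = same_block \<pi> \<union> insert (y, y) ({y} \<times> B \<union> B \<times> {y})"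
    using B by (auto simp: same_block_def \<pi>\<^sub>2_def)
  have elem2: "elem \<pi>\<^sub>2 \<kappa> = elem \<pi> \<kappa> * of_bool (\<forall>j\<in>B. \<kappa> j \<noteq> \<kappa> y)" for \<kappa>
    unfolding elem_def same2 of_bool_conj[symmetric]
    by (rule arg_cong[of _ _ of_bool]) (use y_notin[OF B(1)] in \<open>auto simp: ball_Un\<close>)
  \<comment> \<open>Where \<open>elem \<pi>\<close> does not vanish, the colours on \<open>B\<close>
    are pairwise different, so at most one \<open>j\<close> in \<open>B\<close> shares the colour of
    \<open>y\<close>.\<close>
  have sum_agree: "(\<Sum>j\<in>B. elem \<pi> \<kappa> * agree {(j, y)} \<kappa>) = elem \<pi>\<^sub>1 \<kappa> - elem \<pi>\<^sub>2 \<kappa>" for \<kappa>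
  proof (cases "elem \<pi> \<kappa> = 0")
    case True
    then show ?thesis by (simp add: elem1 elem2)
  next
    case False
    then have inj: "i = j" if "i \<in> B" "j \<in> B" "\<kappa> i = \<kappa> j" for i j
      using that B(1) by (auto simp: elem_def same_block_def split: if_splits)
    have "(\<Sum>j\<in>B. elem \<pi> \<kappa> * agree {(j, y)} \<kappa>) = elem \<pi> \<kappa> * (\<Sum>j\<in>B. of_bool (\<kappa> j = \<kappa> y))"
      by (simp add: agree_def sum_distrib_left)
    also have "(\<Sum>j\<in>B. of_bool (\<kappa> j = \<kappa> y) :: rat) = 1 - of_bool (\<forall>j\<in>B. \<kappa> j \<noteq> \<kappa> y)"
    proof (cases "\<exists>i\<in>B. \<kappa> i = \<kappa> y")
      case True
      then obtain i where "i \<in> B" "\<kappa> i = \<kappa> y" by blast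
      then have "B \<inter> {j. \<kappa> j = \<kappa> y} = {i}" using inj by fastforce
      then show ?thesis using True finB by auto
    next
      case False
      then have "B \<inter> {j. \<kappa> j = \<kappa> y} = {}" by blast
      then show ?thesis using False finB by simp
    qed
    finally show ?thesis by (simp add: elem1 elem2 algebra_simps)
  qed
  have "\<exists>c. elem_expansion W (\<lambda>\<kappa>. elem \<pi> \<kappa> * agree {(j, y)} \<kappa>) c" if "j \<in> B" for j
    using that BV by (intro ex_elem_expansion_elem_agree[OF V W(1) _ _ \<pi>]) (auto simp: W_def)
  then obtain q where q: "\<And>j. j \<in> B \<Longrightarrow> elem_expansion W (\<lambda>\<kappa>. elem \<pi> \<kappa> * agree {(j, y)} \<kappa>) (q j)"
    by metis
  have q_eq: "type_sum W y (q j) t = type_sum W y (q x) t" if j: "j \<in> B" for j t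
  proof (rule type_sum_relabel[OF W(1) _ _ _ W(2) q[OF B(2)] q[OF j], of "transpose j x"])
    have jx: "j \<in> W" "x \<in> W" "y \<noteq> j" "y \<noteq> x" using j x y BV by (auto simp: W_def)
    then show "transpose j x ` W = W" "transpose j x y = y" by auto
    fix \<kappa>
    have swap: "transpose j x ` C = C" if "C \<in> \<pi>" for C
    proof (cases "C = B")
      case True
      then show ?thesis using j B by simp
    next
      case False
      then have "C \<inter> B = {}" using that B(1) partition_onD2[OF \<pi>] by (auto simp: disjoint_def)
      then have "j \<notin> C" "x \<notin> C" using j B by auto
      then show ?thesis by simp
    qed
    have "elem \<pi> (\<kappa> \<circ> transpose j x) = elem \<pi> \<kappa>"
      using swap by (simp add: elem_relabel cong: image_cong)
    moreover have "agree {(x, y)} (\<kappa> \<circ> transpose j x) = agree {(j, y)} \<kappa>"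
      using jx by (simp add: agree_def)
    ultimately show "elem \<pi> \<kappa> * agree {(j, y)} \<kappa>
        = elem \<pi> (\<kappa> \<circ> transpose j x) * agree {(x, y)} (\<kappa> \<circ> transpose j x)" by simp
  qed auto
  have sum_q: "elem_expansion W (\<lambda>\<kappa>. elem \<pi>\<^sub>1 \<kappa> - elem \<pi>\<^sub>2 \<kappa>) (\<lambda>\<sigma>. \<Sum>j\<in>B. q j \<sigma>)"
    unfolding sum_agree[symmetric] by (rule elem_expansion_sum) (rule q)
  have diff: "elem_expansion W (\<lambda>\<kappa>. elem \<pi>\<^sub>1 \<kappa> - elem \<pi>\<^sub>2 \<kappa>) (\<lambda>\<sigma>. of_bool (\<sigma> = \<pi>\<^sub>1) - of_bool (\<sigma> = \<pi>\<^sub>2))"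
    by (intro elem_expansion_diff elem_expansion_elem W \<pi>1 \<pi>2)
  have "of_nat (card B) * type_sum W y (q x) t
      = of_bool (t = partition_type y \<pi>\<^sub>1) - of_bool (t = partition_type y \<pi>\<^sub>2)" for t
  proof -
    have "of_nat (card B) * type_sum W y (q x) t = type_sum W y (\<lambda>\<sigma>. \<Sum>j\<in>B. q j \<sigma>) t"
      by (simp add: type_sum_sum q_eq)
    also have "\<dots> = type_sum W y (\<lambda>\<sigma>. of_bool (\<sigma> = \<pi>\<^sub>1) - of_bool (\<sigma> = \<pi>\<^sub>2)) t"
      by (rule type_sum_unique[OF W(1) sum_q diff])
    finally show ?thesis by (simp add: type_sum_diff type_sum_of_bool W \<pi>1 \<pi>2)
  qed
  then have q_x: "type_sum W y (q x) t
      = (of_bool (t = partition_type y \<pi>\<^sub>1) - of_bool (t = partition_type y \<pi>\<^sub>2)) / of_nat (card B)" for t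
    using cardB by (simp add: field_simps)
  have fin\<pi>: "finite \<pi>" using finite_elements[OF V \<pi>] .
  have block1: "block \<pi>\<^sub>1 y = {y}" by (rule block_eqI[OF \<pi>1]) (auto simp: \<pi>\<^sub>1_def)
  have block2: "block \<pi>\<^sub>2 y = insert y B" by (rule block_eqI[OF \<pi>2]) (auto simp: \<pi>\<^sub>2_def)
  have minus: "\<pi>\<^sub>1 - {{y}} = insert B (\<pi> - {B})" "\<pi>\<^sub>2 - {insert y B} = \<pi> - {B}"
    using y_notin B by (auto simp: \<pi>\<^sub>1_def \<pi>\<^sub>2_def)
  have type0: "partition_type x \<pi> = (image_mset card (mset_set (\<pi> - {B})), card B)"
    by (simp add: partition_type_def B_def)
  have type1: "partition_type y \<pi>\<^sub>1 = (add_mset (card B) (image_mset card (mset_set (\<pi> - {B}))), 1)"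
    unfolding partition_type_def block1 minus using fin\<pi>
    by (subst mset_set.insert) auto
  have type2: "partition_type y \<pi>\<^sub>2 = (image_mset card (mset_set (\<pi> - {B})), card B + 1)"
    unfolding partition_type_def block2 minus using finB y_notin[OF B(1)] by simp
  show thesis
  proof (rule that)
    have "(\<lambda>\<kappa>. elem \<pi> \<kappa> * (1 - agree {(x, y)} \<kappa>))
        = (\<lambda>\<kappa>. elem \<pi>\<^sub>1 \<kappa> - elem \<pi> \<kappa> * agree {(x, y)} \<kappa>)"
      by (simp add: elem1 algebra_simps fun_eq_iff)
    then show "elem_expansion (insert y V) (\<lambda>\<kappa>. elem \<pi> \<kappa> * (1 - agree {(x, y)} \<kappa>))
        (\<lambda>\<sigma>. of_bool (\<sigma> = \<pi>\<^sub>1) - q x \<sigma>)"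
      unfolding W_def[symmetric]
      using elem_expansion_diff[OF elem_expansion_elem[OF W(1) \<pi>1] q[OF B(2)]] by simp
    \<comment> \<open>Removing the share of \<open>j = x\<close>, which is \<open>1 / card B\<close>
      of the difference, leaves the weight \<open>1 - 1 / card B\<close> at the type of
      \<open>\<pi>\<^sub>1\<close> and \<open>1 / card B\<close> at the type of
      \<open>\<pi>\<^sub>2\<close>.\<close>
    show "type_sum (insert y V) y (\<lambda>\<sigma>. of_bool (\<sigma> = \<pi>\<^sub>1) - q x \<sigma>) t = extend_weight (partition_type x \<pi>) t" for t
      unfolding W_def[symmetric] type_sum_diff type_sum_of_bool[OF W(1) \<pi>1] q_x type0 type1 type2
      using cardB by (simp add: extend_weight_def diff_divide_distrib algebra_simps)
  qed
qed

definition elem_positive :: "nat set \<Rightarrow> nat \<Rightarrow> ((nat \<Rightarrow> nat) \<Rightarrow> rat) \<Rightarrow> bool" where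
  "elem_positive V r f \<longleftrightarrow> (\<exists>c. elem_expansion V f c \<and> (\<forall>t. type_sum V r c t \<ge> 0))"

text \<open>The type sums produced by each \<open>elem \<pi>\<close> depend on \<open>\<pi>\<close>
  only through its type. Grouping by types therefore gives combinations of the old type sums with
  the nonnegative weights \<open>extend_weight\<close>.\<close>

lemma elem_positive_extend:
  assumes V: "finite V" and x: "x \<in> V" and y: "y \<notin> V" and f: "elem_positive V x f"
  shows "elem_positive (insert y V) y (\<lambda>\<kappa>. f \<kappa> * (1 - agree {(x, y)} \<kappa>))"
proof -
  obtain c where c: "elem_expansion V f c" and pos: "\<And>t. type_sum V x c t \<ge> 0"
    using f by (auto simp: elem_positive_def)
  have "\<exists>q. elem_expansion (insert y V) (\<lambda>\<kappa>. elem \<pi> \<kappa> * (1 - agree {(x, y)} \<kappa>)) q \<and>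
      (\<forall>t. type_sum (insert y V) y q t = extend_weight (partition_type x \<pi>) t)" if "\<pi> \<in> parts V" for \<pi>
    using elem_extend_type_sum[OF V _ x y, of \<pi>] that by blast
  then obtain q where
    q: "\<And>\<pi>. \<pi> \<in> parts V \<Longrightarrow> elem_expansion (insert y V) (\<lambda>\<kappa>. elem \<pi> \<kappa> * (1 - agree {(x, y)} \<kappa>)) (q \<pi>)"
      "\<And>\<pi> t. \<pi> \<in> parts V \<Longrightarrow> type_sum (insert y V) y (q \<pi>) t = extend_weight (partition_type x \<pi>) t"
    by metis
  have "(\<lambda>\<kappa>. f \<kappa> * (1 - agree {(x, y)} \<kappa>))
      = (\<lambda>\<kappa>. \<Sum>\<pi>\<in>parts V. c \<pi> * (elem \<pi> \<kappa> * (1 - agree {(x, y)} \<kappa>)))"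
    using c by (auto simp: elem_expansion_def sum_distrib_right mult.assoc)
  then have "elem_expansion (insert y V) (\<lambda>\<kappa>. f \<kappa> * (1 - agree {(x, y)} \<kappa>))
      (\<lambda>\<sigma>. \<Sum>\<pi>\<in>parts V. c \<pi> * q \<pi> \<sigma>)"
    by (simp only:) (intro elem_expansion_sum elem_expansion_scale q(1))
  moreover have "type_sum (insert y V) y (\<lambda>\<sigma>. \<Sum>\<pi>\<in>parts V. c \<pi> * q \<pi> \<sigma>) t \<ge> 0" for t
  proof -
    have "type_sum (insert y V) y (\<lambda>\<sigma>. \<Sum>\<pi>\<in>parts V. c \<pi> * q \<pi> \<sigma>) t
        = (\<Sum>\<pi>\<in>parts V. c \<pi> * extend_weight (partition_type x \<pi>) t)"
      unfolding type_sum_sum by (intro sum.cong) (simp_all add: type_sum_scale q(2))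
    also have "\<dots> = (\<Sum>s\<in>partition_type x ` parts V. \<Sum>\<pi>\<in>{\<pi>\<in>parts V. partition_type x \<pi> = s}.
        c \<pi> * extend_weight (partition_type x \<pi>) t)"
      by (rule sum.group[symmetric]) (use finite_parts[OF V] in auto)
    also have "\<dots> = (\<Sum>s\<in>partition_type x ` parts V. type_sum V x c s * extend_weight s t)"
      unfolding type_sum_def sum_distrib_right by (intro sum.cong) auto
    also have "\<dots> \<ge> 0" by (intro sum_nonneg mult_nonneg_nonneg pos extend_weight_nonneg)
    finally show ?thesis .
  qed
  ultimately show ?thesis unfolding elem_positive_def by blast
qed

definition proper :: "nat set set \<Rightarrow> (nat \<Rightarrow> nat) \<Rightarrow> rat" where
  "proper E \<kappa> = of_bool (\<forall>a b. {a, b} \<in> E \<longrightarrow> \<kappa> a \<noteq> \<kappa> b)"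

lemma consecutive_pairs_snoc:
  assumes "xs \<noteq> []"
  shows "consecutive_pairs (xs @ [y]) = insert {last xs, y} (consecutive_pairs xs)"
proof (intro set_eqI iffI, goal_cases)
  case (1 e)
  then obtain i where i: "e = {(xs @ [y]) ! i, (xs @ [y]) ! Suc i}" "Suc i < length (xs @ [y])"
    unfolding consecutive_pairs_def by blast
  show ?case
  proof (cases "Suc i < length xs")
    case True
    then show ?thesis using i by (auto simp: consecutive_pairs_def nth_append)
  next
    case False
    then have "i = length xs - 1" "Suc i = length xs" using i by auto
    then show ?thesis using i assms by (auto simp: nth_append last_conv_nth)
  qed
next
  case (2 e)
  then consider "e = {last xs, y}" | i where "Suc i < length xs" "e = {xs ! i, xs ! Suc i}"
    unfolding consecutive_pairs_def by blast
  then show ?case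
  proof cases
    case 1
    have "e = {(xs @ [y]) ! (length xs - 1), (xs @ [y]) ! Suc (length xs - 1)}"
      using 1 assms by (simp add: nth_append last_conv_nth)
    then show ?thesis using assms unfolding consecutive_pairs_def by fastforce
  next
    case 2
    then have "e = {(xs @ [y]) ! i, (xs @ [y]) ! Suc i}" by (simp add: nth_append)
    then show ?thesis using 2 unfolding consecutive_pairs_def by fastforce
  qed
qed

text \<open>Vertices are appended one at a time, and the distinguished vertex moves along to the new
  end. The new edge multiplies the indicator of proper colourings by the indicator that its two ends
  differ.\<close>

lemma elem_positive_path:
  "xs \<noteq> [] \<Longrightarrow> distinct xs \<Longrightarrow> elem_positive (set xs) (last xs) (proper (consecutive_pairs xs))"
proof (induction xs rule: rev_nonempty_induct)
  case (single x)
  have \<pi>: "partition_on {x} {{x}}" by (auto simp: partition_on_def)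
  have "proper (consecutive_pairs [x]) = elem {{x}}"
    by (auto simp: proper_def consecutive_pairs_def elem_def same_block_def fun_eq_iff)
  moreover have "type_sum {x} x (\<lambda>\<sigma>. of_bool (\<sigma> = {{x}})) t \<ge> 0" for t
    using type_sum_of_bool[OF _ \<pi>] by simp
  ultimately show ?case
    using elem_expansion_elem[OF _ \<pi>] unfolding elem_positive_def by fastforce
next
  case (snoc y xs)
  have "elem_positive (insert y (set xs)) y
      (\<lambda>\<kappa>. proper (consecutive_pairs xs) \<kappa> * (1 - agree {(last xs, y)} \<kappa>))"
    using snoc by (intro elem_positive_extend) auto
  moreover have "proper (consecutive_pairs xs) \<kappa> * (1 - agree {(last xs, y)} \<kappa>)
      = proper (consecutive_pairs (xs @ [y])) \<kappa>" for \<kappa>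
    unfolding consecutive_pairs_snoc[OF snoc.hyps(1)]
    by (auto simp: proper_def agree_def doubleton_eq_iff)
  ultimately show ?case by simp
qed

section \<open>The map to UBCSym\<close>

text \<open>A word determines the extensional colouring that produces it, so each coefficient is 0
  or 1. Labels start at 1 and list positions at 0, whence \<open>i - 1\<close>.\<close>

lemma word_sum_eq:
  assumes P: "\<And>\<kappa> \<kappa>'. (\<And>i. i \<in> {1..d} \<Longrightarrow> \<kappa> i = \<kappa>' i) \<Longrightarrow> P \<kappa> = P \<kappa>'"
  shows "word_sum d P w = of_bool (length w = d \<and> 0 \<notin> set w \<and> P (\<lambda>i. w ! (i - 1)))"
proof -
  define \<kappa>\<^sub>0 where "\<kappa>\<^sub>0 = (\<lambda>i\<in>{1..d}. w ! (i - 1))"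
  define K where "K = {\<kappa> \<in> {1..d} \<rightarrow>\<^sub>E {1..}. P \<kappa> \<and> map \<kappa> [1..<Suc d] = w}"
  have eq: "\<kappa> = \<kappa>\<^sub>0" "length w = d" "0 \<notin> set w" "P (\<lambda>i. w ! (i - 1))" if "\<kappa> \<in> K" for \<kappa>
  proof -
    have \<kappa>: "\<kappa> \<in> {1..d} \<rightarrow>\<^sub>E {1..}" "P \<kappa>" and w: "w = map \<kappa> [1..<Suc d]" using that by (auto simp: K_def)
    have nth: "w ! (i - 1) = \<kappa> i" if "i \<in> {1..d}" for i using that
      by (subst w, subst nth_map) (auto simp del: upt_Suc)
    show "\<kappa> = \<kappa>\<^sub>0"
      using \<kappa>(1) nth by (intro extensionalityI[of _ "{1..d}"]) (auto simp: \<kappa>\<^sub>0_def PiE_def)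
    show "length w = d" by (simp add: w del: upt_Suc)
    show "0 \<notin> set w" using \<kappa>(1) by (force simp: w PiE_def Pi_def simp del: upt_Suc)
    show "P (\<lambda>i. w ! (i - 1))" using P[of "\<lambda>i. w ! (i - 1)" \<kappa>] nth \<kappa>(2) by simp
  qed
  have "\<kappa>\<^sub>0 \<in> K" if "length w = d" "0 \<notin> set w" "P (\<lambda>i. w ! (i - 1))"
  proof -
    have "w ! (i - 1) \<noteq> 0" if "i \<in> {1..d}" for i
    proof -
      have "i - 1 < length w" using that \<open>length w = d\<close> by auto
      then show ?thesis using \<open>0 \<notin> set w\<close> nth_mem by metis
    qed
    then have "\<kappa>\<^sub>0 \<in> {1..d} \<rightarrow>\<^sub>E {1..}"
      unfolding \<kappa>\<^sub>0_def by (intro restrict_PiE_iff[THEN iffD2]) (simp add: Suc_le_eq)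
    moreover have "map \<kappa>\<^sub>0 [1..<Suc d] = w"
      using that(1) by (intro nth_equalityI) (simp_all add: \<kappa>\<^sub>0_def del: upt_Suc)
    moreover have "P \<kappa>\<^sub>0" using P[of \<kappa>\<^sub>0 "\<lambda>i. w ! (i - 1)"] that(3) by (simp add: \<kappa>\<^sub>0_def)
    ultimately show ?thesis by (simp only: K_def mem_Collect_eq simp_thms)
  qed
  with eq have "K = (if length w = d \<and> 0 \<notin> set w \<and> P (\<lambda>i. w ! (i - 1)) then {\<kappa>\<^sub>0} else {})"
    by auto
  then show ?thesis unfolding word_sum_def K_def[symmetric] by simp
qed

text \<open>Only coincidences of colours count, so colours may be renamed injectively.\<close>

lemma elem_cong:
  assumes "partition_on V \<pi>" "\<And>a b. a \<in> V \<Longrightarrow> b \<in> V \<Longrightarrow> \<kappa> a = \<kappa> b \<longleftrightarrow> \<kappa>' a = \<kappa>' b"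
  shows "elem \<pi> \<kappa> = elem \<pi> \<kappa>'"
  unfolding elem_def using same_block_subset[OF assms(1)] assms(2)
  by (intro arg_cong[of _ _ of_bool] ball_cong) auto

lemma nc_e_eq:
  assumes "partition_on {1..d} \<pi>"
  shows "nc_e d \<pi> w = of_bool (length w = d \<and> 0 \<notin> set w) * elem \<pi> (\<lambda>i. w ! (i - 1))"
proof -
  have "block \<pi> j = block \<pi> k \<longleftrightarrow> (j, k) \<in> same_block \<pi>" if "j \<in> {1..d}" "k \<in> {1..d}" for j k
    using block_in[OF assms that(1)] block_in[OF assms that(2)] block_eqI[OF assms]
    by (auto simp: same_block_def)
  then have "(\<forall>j\<in>{1..d}. \<forall>k\<in>{1..d}. j \<noteq> k \<and> block \<pi> j = block \<pi> k \<longrightarrow> \<kappa> j \<noteq> \<kappa> k)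
      \<longleftrightarrow> (\<forall>(j, k)\<in>same_block \<pi>. j \<noteq> k \<longrightarrow> \<kappa> j \<noteq> \<kappa> k)" for \<kappa> :: "nat \<Rightarrow> nat"
    using same_block_subset[OF assms] unfolding Ball_def split_paired_All prod.case by blast
  then show ?thesis
    unfolding nc_e_def by (subst word_sum_eq) (auto simp: elem_def)
qed

lemma nc_Y_eq:
  assumes "\<And>e. e \<in> E \<Longrightarrow> e \<subseteq> {1..d}"
  shows "nc_Y d E w = of_bool (length w = d \<and> 0 \<notin> set w) * proper E (\<lambda>i. w ! (i - 1))"
proof -
  have "(\<forall>j\<in>{1..d}. \<forall>k\<in>{1..d}. {j, k} \<in> E \<longrightarrow> \<kappa> j \<noteq> \<kappa> k)
      \<longleftrightarrow> (\<forall>j k. {j, k} \<in> E \<longrightarrow> \<kappa> j \<noteq> \<kappa> k)" for \<kappa> :: "nat \<Rightarrow> nat"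
    using assms by blast
  then show ?thesis
    unfolding nc_Y_def by (subst word_sum_eq) (auto simp: proper_def)
qed

lemma sum_nc_scale_apply: "(\<Sum>i\<in>I. nc_scale (c i) (f i)) w = (\<Sum>i\<in>I. c i * f i w)"
  by (induction I rule: infinite_finite_induct) (auto simp: nc_scale_def)

text \<open>The expansion is evaluated at the colouring read off from a word; a word of wrong length
  or with the letter 0 has coefficient 0 on both sides.\<close>

lemma nc_Y_expansion:
  assumes "\<And>e. e \<in> E \<Longrightarrow> e \<subseteq> {1..d}" "elem_expansion {1..d} (proper E) c"
  shows "nc_Y d E = (\<Sum>\<pi>\<in>set_partitions d. nc_scale (c \<pi>) (nc_e d \<pi>))"
proof
  fix w
  show "nc_Y d E w = (\<Sum>\<pi>\<in>set_partitions d. nc_scale (c \<pi>) (nc_e d \<pi>)) w"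
  proof (subst nc_Y_eq)
    have "of_bool (length w = d \<and> 0 \<notin> set w) * proper E (\<lambda>i. w ! (i - 1))
        = (\<Sum>\<pi>\<in>set_partitions d. c \<pi> * nc_e d \<pi> w)"
    proof -
      have "of_bool (length w = d \<and> 0 \<notin> set w) * proper E (\<lambda>i. w ! (i - 1))
          = (\<Sum>\<pi>\<in>parts {1..d}. of_bool (length w = d \<and> 0 \<notin> set w) * (c \<pi> * elem \<pi> (\<lambda>i. w ! (i - 1))))"
        using assms(2) unfolding elem_expansion_def by (simp only: sum_distrib_left)
      also have "\<dots> = (\<Sum>\<pi>\<in>set_partitions d. c \<pi> * nc_e d \<pi> w)"
        unfolding set_partitions_def by (intro sum.cong) (simp_all add: nc_e_eq)
      finally show ?thesis .
    qed
    then show "of_bool (length w = d \<and> 0 \<notin> set w) * proper E (\<lambda>i. w ! (i - 1))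
        = (\<Sum>\<pi>\<in>set_partitions d. nc_scale (c \<pi>) (nc_e d \<pi>)) w"
      by (simp only: sum_nc_scale_apply)
  qed (rule assms(1))
qed

lemma nc_e_independent:
  assumes zero: "(\<Sum>\<pi>\<in>set_partitions d. nc_scale (c \<pi>) (nc_e d \<pi>)) = 0" and "\<pi> \<in> set_partitions d"
  shows "c \<pi> = 0"
proof (rule elem_independent[of "{1..d}"])
  fix \<kappa> :: "nat \<Rightarrow> nat"
  \<comment> \<open>Letters must be positive while \<open>\<kappa>\<close> may take the value 0, so
    the test word uses the colours shifted by one.\<close>
  define w where "w = map (Suc \<circ> \<kappa>) [1..<Suc d]"
  have w: "length w = d" "0 \<notin> set w" "\<And>i. i \<in> {1..d} \<Longrightarrow> w ! (i - 1) = Suc (\<kappa> i)"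
    by (auto simp: w_def simp del: upt_Suc)
  have "elem \<pi> \<kappa> = nc_e d \<pi> w" if "\<pi> \<in> parts {1..d}" for \<pi>
  proof -
    have "elem \<pi> \<kappa> = elem \<pi> (\<lambda>i. w ! (i - 1))"
      using that w(3) by (intro elem_cong[of "{1..d}"]) auto
    then show ?thesis using that w(1,2) by (simp add: nc_e_eq)
  qed
  then have "(\<Sum>\<pi>\<in>parts {1..d}. c \<pi> * elem \<pi> \<kappa>)
      = (\<Sum>\<pi>\<in>set_partitions d. nc_scale (c \<pi>) (nc_e d \<pi>)) w"
    unfolding sum_nc_scale_apply set_partitions_def by (intro sum.cong) auto
  also have "\<dots> = 0" unfolding zero by simp
  finally show "(\<Sum>\<pi>\<in>parts {1..d}. c \<pi> * elem \<pi> \<kappa>) = 0" .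
qed (use assms(2) in \<open>auto simp: set_partitions_def\<close>)

lemma finite_set_partitions: "finite (set_partitions d)"
  unfolding set_partitions_def by (rule finite_parts) simp

text \<open>Equal values at two partitions would be a linear dependence with coefficients 1 and -1.
  Injectivity lets \<open>nu\<close> recover the partition from its basis element.\<close>

lemma inj_on_nc_e: "inj_on (nc_e d) (set_partitions d)"
proof (rule inj_onI, rule ccontr)
  fix \<pi> \<sigma> assume *: "\<pi> \<in> set_partitions d" "\<sigma> \<in> set_partitions d" "nc_e d \<pi> = nc_e d \<sigma>" "\<pi> \<noteq> \<sigma>"
  define c :: "nat set set \<Rightarrow> rat" where "c \<rho> = of_bool (\<rho> = \<pi>) - of_bool (\<rho> = \<sigma>)" for \<rho>
  have "(\<Sum>\<rho>\<in>set_partitions d. nc_scale (c \<rho>) (nc_e d \<rho>)) = 0"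
  proof
    fix w
    have "(\<Sum>\<rho>\<in>set_partitions d. c \<rho> * nc_e d \<rho> w)
        = (\<Sum>\<rho>\<in>set_partitions d. if \<rho> = \<pi> then nc_e d \<pi> w else 0)
          - (\<Sum>\<rho>\<in>set_partitions d. if \<rho> = \<sigma> then nc_e d \<sigma> w else 0)"
      unfolding sum_subtractf[symmetric] by (intro sum.cong) (auto simp: c_def)
    then show "(\<Sum>\<rho>\<in>set_partitions d. nc_scale (c \<rho>) (nc_e d \<rho>)) w = 0 w"
      using * finite_set_partitions unfolding sum_nc_scale_apply by (simp add: sum.delta)
  qed
  then have "c \<pi> = 0" using * by (intro nc_e_independent)
  then show False using * by (simp add: c_def)
qed

lemma independent_nc_e: "nc_ubc.vs1.independent (nc_e d ` set_partitions d)"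
proof (subst nc_ubc.vs1.dependent_finite)
  show "finite (nc_e d ` set_partitions d)" using finite_set_partitions by simp
  show "\<not> (\<exists>u. (\<exists>v\<in>nc_e d ` set_partitions d. u v \<noteq> 0)
      \<and> (\<Sum>v\<in>nc_e d ` set_partitions d. nc_scale (u v) v) = 0)"
    using nc_e_independent[of "\<lambda>\<pi>. _ (nc_e d \<pi>)"] by (auto simp: sum.reindex[OF inj_on_nc_e])
qed

lemma nu_expansion:
  "nu d (\<Sum>\<pi>\<in>set_partitions d. nc_scale (c \<pi>) (nc_e d \<pi>))
    = (\<Sum>\<pi>\<in>set_partitions d. ubc_scale (c \<pi>) (ubc_e (partition_type d \<pi>)))"
proof -
  have lin: "Vector_Spaces.linear nc_scale ubc_scale (nu d)"
    unfolding nu_def by (rule nc_ubc.linear_construct[OF independent_nc_e])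
  have "nu d (nc_e d \<pi>) = ubc_e (partition_type d \<pi>)" if "\<pi> \<in> set_partitions d" for \<pi>
    unfolding nu_def
    using that nc_ubc.construct_basis[OF independent_nc_e, of "nc_e d \<pi>" d]
    by (simp add: the_inv_into_f_f[OF inj_on_nc_e])
  then show ?thesis
    by (simp add: nc_ubc.linear_sum[OF lin] nc_ubc.linear_scale[OF lin] cong: sum.cong)
qed

text \<open>Reduces positivity to type sums of an arbitrary expansion of the indicator of proper
  colourings; the series and vector spaces are left behind here.\<close>

lemma lookup_ubc_y:
  assumes "\<And>e. e \<in> E \<Longrightarrow> e \<subseteq> {1..d}" "elem_expansion {1..d} (proper E) c"
  shows "Poly_Mapping.lookup (ubc_y d E) t = type_sum {1..d} d c t"
proof -
  have Y: "nc_Y d E = (\<Sum>\<pi>\<in>set_partitions d. nc_scale (c \<pi>) (nc_e d \<pi>))"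
    by (rule nc_Y_expansion) (fact assms)+
  have "Poly_Mapping.lookup (ubc_y d E) t
      = (\<Sum>\<pi>\<in>set_partitions d. c \<pi> * (1 when partition_type d \<pi> = t))"
    unfolding ubc_y_def Y nu_expansion
    by (simp add: lookup_sum ubc_e_def lookup_single)
  also have "\<dots> = (\<Sum>\<pi>\<in>set_partitions d. if partition_type d \<pi> = t then c \<pi> else 0)"
    by (intro sum.cong) auto
  also have "\<dots> = type_sum {1..d} d c t"
    unfolding type_sum_def sum.inter_filter[OF finite_set_partitions, symmetric]
    by (intro sum.cong) (auto simp: set_partitions_def)
  finally show ?thesis .
qed

section \<open>Trees all of whose initial splits are connected\<close>

abbreviation adj :: "'a set set \<Rightarrow> ('a \<times> 'a) set" where
  "adj E \<equiv> {(a, b). {a, b} \<in> E}"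

lemma consecutive_pairs_append: "consecutive_pairs xs \<subseteq> consecutive_pairs (xs @ ys)"
proof
  fix e assume "e \<in> consecutive_pairs xs"
  then obtain i where "e = {xs ! i, xs ! Suc i}" "Suc i < length xs"
    unfolding consecutive_pairs_def by blast
  then have "e = {(xs @ ys) ! i, (xs @ ys) ! Suc i}" "Suc i < length (xs @ ys)"
    by (auto simp: nth_append)
  then show "e \<in> consecutive_pairs (xs @ ys)" unfolding consecutive_pairs_def by blast
qed

lemma consecutive_pairs_rev: "consecutive_pairs (rev xs) = consecutive_pairs xs"
proof -
  have "consecutive_pairs ys \<subseteq> consecutive_pairs (rev ys)" for ys :: "'a list"
  proof
    fix e assume "e \<in> consecutive_pairs ys"
    then obtain i where i: "e = {ys ! i, ys ! Suc i}" "Suc i < length ys"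
      unfolding consecutive_pairs_def by blast
    define j where "j = length ys - Suc (Suc i)"
    have "e = {rev ys ! j, rev ys ! Suc j}" "Suc j < length (rev ys)"
      using i by (auto simp: j_def rev_nth Suc_diff_Suc)
    then show "e \<in> consecutive_pairs (rev ys)" unfolding consecutive_pairs_def by blast
  qed
  from this[of xs] this[of "rev xs"] show ?thesis by auto
qed

lemma consecutive_pairs_eq_image:
  "consecutive_pairs xs = (\<lambda>i. {xs ! i, xs ! Suc i}) ` {i. Suc i < length xs}"
  by (auto simp: consecutive_pairs_def)

lemma consecutive_pairs_map: "consecutive_pairs (map f xs) = (`) f ` consecutive_pairs xs"
  unfolding consecutive_pairs_eq_image image_image by (intro image_cong) auto

text \<open>A path is extended by one step at a time; when the new vertex already lies on it, the
  path is cut off there.\<close>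

lemma rtrancl_adj_imp_path:
  "(a, b) \<in> (adj F)\<^sup>* \<Longrightarrow>
    \<exists>xs. xs \<noteq> [] \<and> distinct xs \<and> hd xs = a \<and> last xs = b \<and> consecutive_pairs xs \<subseteq> F"
proof (induction rule: rtrancl_induct)
  case base
  show ?case by (intro exI[of _ "[a]"]) (auto simp: consecutive_pairs_def)
next
  case (step y z)
  then obtain xs where xs: "xs \<noteq> []" "distinct xs" "hd xs = a" "last xs = y" "consecutive_pairs xs \<subseteq> F"
    by blast
  show ?case
  proof (cases "z \<in> set xs")
    case True
    then obtain us vs where us: "xs = (us @ [z]) @ vs" by (metis append_Cons append_Nil append_assoc split_list)
    then have "consecutive_pairs (us @ [z]) \<subseteq> F" using xs(5) consecutive_pairs_append by blast
    moreover have "hd (us @ [z]) = a" using us xs(3) by (cases us) auto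
    ultimately show ?thesis using us xs(2) by (intro exI[of _ "us @ [z]"]) auto
  next
    case False
    then show ?thesis
      using xs step(2) by (intro exI[of _ "xs @ [z]"]) (auto simp: consecutive_pairs_snoc)
  qed
qed

text \<open>A path from \<open>a\<close> to \<open>b\<close> that avoids their edge would be closed
  to a cycle by it.\<close>

lemma tree_graph_bridge:
  assumes "tree_graph V E" "{a, b} \<in> E"
  shows "(a, b) \<notin> (adj (E - {{a, b}}))\<^sup>*"
proof
  assume "(a, b) \<in> (adj (E - {{a, b}}))\<^sup>*"
  from rtrancl_adj_imp_path[OF this]
  obtain xs where xs: "xs \<noteq> []" "distinct xs" "hd xs = a" "last xs = b"
    and pairs: "consecutive_pairs xs \<subseteq> E - {{a, b}}"
    by (elim exE conjE) (rule that)
  have "card {a, b} = 2" using assms by (auto simp: tree_graph_def simple_graph_def)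
  then have "a \<noteq> b" by auto
  \<comment> \<open>A path with two vertices would be the removed edge itself.\<close>
  have "length xs \<ge> 3"
  proof (rule ccontr)
    assume short: "\<not> length xs \<ge> 3"
    obtain x ys where x: "xs = x # ys" using xs(1) by (cases xs) auto
    then have "ys \<noteq> []" using xs \<open>a \<noteq> b\<close> by auto
    then obtain y zs where "ys = y # zs" by (cases ys) auto
    moreover from this have "zs = []" using x short by (cases zs) auto
    ultimately have "xs = [a, b]" using x xs by auto
    then have "{a, b} \<in> consecutive_pairs xs" by (auto simp: consecutive_pairs_def)
    then show False using pairs by blast
  qed
  then have "graph_cycle E xs" using xs pairs assms(2) by (auto simp: graph_cycle_def insert_commute)
  then show False using assms(1) by (auto simp: tree_graph_def)
qed

lemma rtrancl_leaves_set:
  "(a, b) \<in> r\<^sup>* \<Longrightarrow> a \<in> S \<Longrightarrow> b \<notin> S \<Longrightarrow> \<exists>c d. (c, d) \<in> r \<and> c \<in> S \<and> d \<notin> S"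
  by (induction rule: rtrancl_induct) blast+

text \<open>The vertices of the path are found one after the other: if \<open>xs\<close> are the first \<open>n\<close> of them,
  the connected set of size \<open>n\<close> must be \<open>set xs\<close>, and since its complement is connected, only one
  edge leaves it.\<close>

lemma tree_initial_path:
  assumes tree: "tree_graph V E" and v: "v \<in> V"
    and split: "\<And>b. 1 \<le> b \<Longrightarrow> b < card V \<Longrightarrow> \<exists>B. v \<in> B \<and> B \<subseteq> V \<and> card B = b \<and>
      connected_graph B (E \<inter> Pow B) \<and> connected_graph (V - B) (E \<inter> Pow (V - B))"
    and n: "1 \<le> n" "n \<le> card V"
  shows "\<exists>xs. length xs = n \<and> distinct xs \<and> hd xs = v \<and> set xs \<subseteq> V \<and>
    consecutive_pairs xs = E \<inter> Pow (set xs) \<and>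
    (\<forall>i u. Suc i < length xs \<longrightarrow> {xs ! i, u} \<in> E \<longrightarrow> u \<in> set xs)"
  using n
proof (induction n rule: dec_induct)
  case base
  have "card e = 2" if "e \<in> E" for e using tree that by (auto simp: tree_graph_def simple_graph_def)
  then have "E \<inter> Pow {v} = {}" by (fastforce simp: subset_singleton_iff)
  then show ?case using v by (intro exI[of _ "[v]"]) (auto simp: consecutive_pairs_def)
next
  case (step n)
  then obtain xs where xs: "length xs = n" "distinct xs" "hd xs = v" "set xs \<subseteq> V"
    and pairs: "consecutive_pairs xs = E \<inter> Pow (set xs)"
    and inner: "\<And>i u. Suc i < length xs \<Longrightarrow> {xs ! i, u} \<in> E \<Longrightarrow> u \<in> set xs"
    by (metis Suc_leD)
  have V: "finite V" and E: "\<And>e. e \<in> E \<Longrightarrow> e \<subseteq> V" "\<And>e. e \<in> E \<Longrightarrow> card e = 2"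
    and conn: "connected_graph V E"
    using tree by (auto simp: tree_graph_def simple_graph_def)
  have n: "1 \<le> n" "n < card V" "xs \<noteq> []" using step xs by auto
  then have v0: "v = xs ! 0" using xs(3) by (simp add: hd_conv_nth)
  obtain B where B: "v \<in> B" "B \<subseteq> V" "card B = n" "connected_graph B (E \<inter> Pow B)"
    "connected_graph (V - B) (E \<inter> Pow (V - B))"
    using split n by blast
  have finB: "finite B" using B(2) V finite_subset by blast
  have "i < n \<Longrightarrow> xs ! i \<in> B" for i
  proof (induction i rule: less_induct)
    case (less i)
    show ?case
    proof (cases i)
      case 0
      then show ?thesis using v0 B by simp
    next
      case (Suc k)
      show ?thesis
      proof (rule ccontr)
        assume notin: "xs ! i \<notin> B"
        \<comment> \<open>\<open>D\<close> consists of the path vertices before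
          \<open>xs ! i\<close>. They have neighbours only on the path, so a connected
          \<open>B\<close> that misses \<open>xs ! i\<close> cannot leave \<open>D\<close>, and
          \<open>D\<close> has fewer than \<open>n\<close> elements.\<close>
        define D where "D = (!) xs ` {..k}"
        have "B \<subseteq> D"
        proof (rule ccontr)
          assume "\<not> B \<subseteq> D"
          then obtain w where "w \<in> B" "w \<notin> D" by blast
          moreover have "v \<in> D" using v0 by (auto simp: D_def)
          moreover have "(v, w) \<in> (adj (E \<inter> Pow B))\<^sup>*"
            using B \<open>w \<in> B\<close> by (auto simp: connected_graph_def)
          ultimately obtain y z where yz: "{y, z} \<in> E" "z \<in> B" "y \<in> D" "z \<notin> D"
            using rtrancl_leaves_set[of v w _ D] by blast
          then obtain j where j: "y = xs ! j" "j \<le> k" by (auto simp: D_def)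
          then have "Suc j < length xs" using Suc less.prems xs(1) by simp
          then have "z \<in> set xs" using inner j yz by blast
          moreover have "y \<in> set xs" using j \<open>Suc j < length xs\<close> by simp
          ultimately have "{y, z} \<in> consecutive_pairs xs" using pairs yz by blast
          then obtain l where l: "{y, z} = {xs ! l, xs ! Suc l}" "Suc l < length xs"
            unfolding consecutive_pairs_def by blast
          then consider "y = xs ! l" "z = xs ! Suc l" | "y = xs ! Suc l" "z = xs ! l"
            by (auto simp: doubleton_eq_iff)
          then show False
          proof cases
            case 1
            then have "l = j" using j l \<open>Suc j < length xs\<close> xs(2) by (simp add: nth_eq_iff_index_eq)
            then have "Suc l \<le> k \<or> Suc l = i" using j Suc by auto
            then show False using 1 yz notin by (auto simp: D_def)
          next
            case 2
            then have "Suc l = j" using j l \<open>Suc j < length xs\<close> xs(2) by (simp add: nth_eq_iff_index_eq)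
            then show False using 2 yz j by (auto simp: D_def)
          qed
        qed
        then have "card B \<le> card D" by (intro card_mono) (auto simp: D_def)
        also have "\<dots> \<le> Suc k" unfolding D_def using card_image_le[of "{..k}"] by simp
        finally show False using B(3) less.prems Suc by simp
      qed
    qed
  qed
  then have "set xs \<subseteq> B" using xs(1) by (auto simp: in_set_conv_nth)
  moreover have "card (set xs) = card B" using xs B by (simp add: distinct_card)
  ultimately have BX: "B = set xs" using card_subset_eq[OF finB] by blast
  have last_in: "last xs \<in> B" using n BX by simp
  obtain w where "w \<in> V" "w \<notin> B" using n B V by (metis card_mono finB not_le subsetI)
  then have "(v, w) \<in> (adj E)\<^sup>*" using conn v by (auto simp: connected_graph_def)
  then obtain c u where cu: "{c, u} \<in> E" "c \<in> B" "u \<notin> B"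
    using rtrancl_leaves_set[of v w _ B] \<open>w \<notin> B\<close> B(1) by blast
  \<comment> \<open>The other path vertices have all their neighbours on the path, so an edge
    leaving \<open>B\<close> starts at the end of the path.\<close>
  have outer: "c = last xs" if "{c, u} \<in> E" "c \<in> B" "u \<notin> B" for c u
  proof -
    obtain i where i: "c = xs ! i" "i < length xs" using \<open>c \<in> B\<close> BX by (auto simp: in_set_conv_nth)
    then have "\<not> Suc i < length xs" using inner that BX by blast
    then show ?thesis using i n by (simp add: last_conv_nth le_less_Suc_eq not_less_eq)
  qed
  have u: "{last xs, u} \<in> E" "u \<in> V" using cu outer E(1)[OF cu(1)] by auto
  \<comment> \<open>Otherwise \<open>u\<close> and \<open>p\<close> are joined inside the connected
    complement of \<open>B\<close>, and going through \<open>u\<close> bypasses the bridge from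
    \<open>last xs\<close> to \<open>p\<close>.\<close>
  have unique: "p = u" if p: "{last xs, p} \<in> E" "p \<notin> B" for p
  proof (rule ccontr)
    assume "p \<noteq> u"
    have "p \<in> V" using E(1)[OF p(1)] by simp
    then have "(u, p) \<in> (adj (E \<inter> Pow (V - B)))\<^sup>*"
      using B(5) u p cu by (auto simp: connected_graph_def)
    moreover have "adj (E \<inter> Pow (V - B)) \<subseteq> adj (E - {{last xs, p}})"
      using last_in by (auto simp: doubleton_eq_iff)
    ultimately have "(u, p) \<in> (adj (E - {{last xs, p}}))\<^sup>*" by (meson in_mono rtrancl_mono)
    moreover have "(last xs, u) \<in> adj (E - {{last xs, p}})"
      using u \<open>p \<noteq> u\<close> last_in cu by (auto simp: doubleton_eq_iff)
    ultimately have "(last xs, p) \<in> (adj (E - {{last xs, p}}))\<^sup>*" by (rule converse_rtrancl_into_rtrancl[rotated])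
    then show False using tree_graph_bridge[OF tree p(1)] by blast
  qed
  show ?case
  proof (intro exI[of _ "xs @ [u]"] conjI allI impI)
    show "length (xs @ [u]) = Suc n" "hd (xs @ [u]) = v" "set (xs @ [u]) \<subseteq> V"
      using xs n u by auto
    show "distinct (xs @ [u])" using xs cu BX by simp
    have new: "e = {last xs, u}" if e: "e \<in> E" "e \<subseteq> insert u (set xs)" "\<not> e \<subseteq> set xs" for e
    proof -
      obtain a b where ab: "e = {a, b}" "a \<noteq> b" using E(2)[OF e(1)] by (auto simp: card_2_iff)
      then have "\<exists>c. e = {c, u} \<and> c \<in> set xs" using e(2,3) by auto
      then show ?thesis using outer e(1) BX cu by blast
    qed
    show "consecutive_pairs (xs @ [u]) = E \<inter> Pow (set (xs @ [u]))"
      unfolding consecutive_pairs_snoc[OF n(3)] pairs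
    proof (intro set_eqI iffI, goal_cases)
      case (1 e)
      then show ?case using u(1) last_in BX by auto
    next
      case (2 e)
      then show ?case using new[of e] by (cases "e \<subseteq> set xs") simp_all
    qed
    fix i p assume i: "Suc i < length (xs @ [u])" "{(xs @ [u]) ! i, p} \<in> E"
    show "p \<in> set (xs @ [u])"
    proof (cases "Suc i < length xs")
      case True
      then show ?thesis using inner[of i p] i by (simp add: nth_append)
    next
      case False
      then have "(xs @ [u]) ! i = last xs" using i(1) n(3) by (simp add: nth_append last_conv_nth le_less_Suc_eq not_less_eq)
      then show ?thesis using unique[of p] i BX by auto
    qed
  qed
qed

lemma tree_path_with_endpoint:
  assumes tree: "tree_graph V E" and v: "v \<in> V"
    and split: "\<And>b. 1 \<le> b \<Longrightarrow> b < card V \<Longrightarrow> \<exists>B. v \<in> B \<and> B \<subseteq> V \<and> card B = b \<and>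
      connected_graph B (E \<inter> Pow B) \<and> connected_graph (V - B) (E \<inter> Pow (V - B))"
  shows "path_with_endpoint V E v"
proof -
  have V: "finite V" and E: "\<And>e. e \<in> E \<Longrightarrow> e \<subseteq> V"
    using tree by (auto simp: tree_graph_def simple_graph_def)
  have "card V \<ge> 1" using V v by (metis One_nat_def Suc_leI card_gt_0_iff empty_iff)
  then obtain xs where xs: "length xs = card V" "distinct xs" "hd xs = v" "set xs \<subseteq> V"
      "consecutive_pairs xs = E \<inter> Pow (set xs)"
    using tree_initial_path[OF tree v split, of "card V"] by blast
  then have "set xs = V" using card_subset_eq[OF V xs(4)] by (simp add: distinct_card)
  moreover have "E \<inter> Pow V = E" using E by blast
  moreover have "xs \<noteq> []" using \<open>card V \<ge> 1\<close> xs(1) by auto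
  ultimately show ?thesis unfolding path_with_endpoint_def using xs by metis
qed

section \<open>Power sum expansion of the proper colourings of a graph\<close>

text \<open>Inclusion-exclusion: the product over all edges of one minus the indicator of a
  monochromatic edge is multiplied out over edge subsets.\<close>

lemma proper_eq_sum_agree:
  assumes "finite E"
  shows "(\<And>e. e \<in> E \<Longrightarrow> card e = 2) \<Longrightarrow>
    proper E \<kappa> = (\<Sum>S\<in>Pow E. (-1) ^ card S * agree (adj S) \<kappa>)"
proof -
  assume card2: "\<And>e. e \<in> E \<Longrightarrow> card e = 2"
  have prod: "(\<Prod>e\<in>S. - agree (adj {e}) \<kappa>) = (-1) ^ card S * agree (adj S) \<kappa>" if "S \<subseteq> E" for S
  proof -
    have "finite S" using that assms finite_subset by blast
    moreover have "adj S = (\<Union>e\<in>S. adj {e})" by auto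
    ultimately show ?thesis
      unfolding prod_uminus using agree_Union_prod[of S "\<lambda>e. adj {e}" \<kappa>] by (simp only:)
  qed
  have "(\<Sum>S\<in>Pow E. (-1) ^ card S * agree (adj S) \<kappa>)
      = (\<Sum>S\<in>Pow E. (\<Prod>e\<in>S. - agree (adj {e}) \<kappa>) * (\<Prod>e\<in>E - S. 1))"
    by (intro sum.cong) (simp_all only: prod Pow_iff prod.neutral_const mult_1_right)
  also have "\<dots> = (\<Prod>e\<in>E. - agree (adj {e}) \<kappa> + 1)" by (rule prod_add[OF assms, symmetric])
  also have "\<dots> = (\<Prod>e\<in>E. of_bool (\<forall>a b. {a, b} = e \<longrightarrow> \<kappa> a \<noteq> \<kappa> b))"
  proof (intro prod.cong refl)
    fix e assume "e \<in> E"
    then obtain a b where "e = {a, b}" "a \<noteq> b" using card2 by (metis card_2_iff)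
    then show "- agree (adj {e}) \<kappa> + 1 = of_bool (\<forall>a b. {a, b} = e \<longrightarrow> \<kappa> a \<noteq> \<kappa> b)"
      by (auto simp: agree_def doubleton_eq_iff)
  qed
  also have "\<dots> = proper E \<kappa>"
  proof (cases "\<forall>a b. {a, b} \<in> E \<longrightarrow> \<kappa> a \<noteq> \<kappa> b")
    case True
    then show ?thesis unfolding proper_def by (subst prod.neutral) auto
  next
    case False
    then show ?thesis unfolding proper_def using assms by (subst prod_zero) auto
  qed
  finally show ?thesis by simp
qed

lemma adj_subset: "(\<And>e. e \<in> E \<Longrightarrow> e \<subseteq> V) \<Longrightarrow> adj E \<subseteq> V \<times> V"
  by auto

text \<open>The function has two expansions in power sums, one through the elementary functions and
  one through edge subsets; independence of the power sums equates their coefficients.\<close>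

lemma proper_expansion_agree_coeff:
  assumes V: "finite V" and E: "\<And>e. e \<in> E \<Longrightarrow> e \<subseteq> V" "\<And>e. e \<in> E \<Longrightarrow> card e = 2"
    and c: "elem_expansion V (proper E) c" and \<tau>: "partition_on V \<tau>"
  shows "(\<Sum>\<pi>\<in>parts V. c \<pi> * elem_coeff V \<pi> \<tau>)
    = (\<Sum>S | S \<subseteq> E \<and> components V (adj S) = \<tau>. (-1) ^ card S)"
proof -
  have finE: "finite E" using V E(1) by (auto intro: finite_subset[of E "Pow V"])
  let ?a = "\<lambda>\<tau>. \<Sum>\<pi>\<in>parts V. c \<pi> * elem_coeff V \<pi> \<tau>"
  let ?b = "\<lambda>\<tau>. \<Sum>S\<in>{S\<in>Pow E. components V (adj S) = \<tau>}. (-1) ^ card S :: rat"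
  have a: "(\<Sum>\<tau>\<in>parts V. ?a \<tau> * agree (same_block \<tau>) \<kappa>) = proper E \<kappa>" for \<kappa>
  proof -
    have "(\<Sum>\<tau>\<in>parts V. ?a \<tau> * agree (same_block \<tau>) \<kappa>) = (\<Sum>\<pi>\<in>parts V. c \<pi> * elem \<pi> \<kappa>)"
      unfolding sum_distrib_right
      by (subst sum.swap) (auto intro!: sum.cong simp: elem_eq_sum_agree[OF V] sum_distrib_left mult.assoc)
    then show ?thesis using c by (simp add: elem_expansion_def)
  qed
  have b: "(\<Sum>\<tau>\<in>parts V. ?b \<tau> * agree (same_block \<tau>) \<kappa>) = proper E \<kappa>" for \<kappa>
  proof -
    have "agree (same_block (components V (adj S))) = agree (adj S)" if "S \<subseteq> E" for S
      using that E(1) by (intro agree_components adj_subset) blast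
    then have "(\<Sum>\<tau>\<in>parts V. ?b \<tau> * agree (same_block \<tau>) \<kappa>)
        = (\<Sum>\<tau>\<in>parts V. \<Sum>S\<in>{S\<in>Pow E. components V (adj S) = \<tau>}. (-1) ^ card S * agree (adj S) \<kappa>)"
      unfolding sum_distrib_right by (intro sum.cong refl) auto
    also have "\<dots> = (\<Sum>S\<in>Pow E. (-1) ^ card S * agree (adj S) \<kappa>)"
      by (rule sum.group) (use finE finite_parts[OF V] in auto)
    finally show ?thesis using proper_eq_sum_agree[OF finE E(2)] by simp
  qed
  have "(\<Sum>\<tau>\<in>parts V. (?a \<tau> - ?b \<tau>) * agree (same_block \<tau>) \<kappa>) = 0" for \<kappa>
    unfolding left_diff_distrib sum_subtractf a b by simp
  then have "?a \<tau> - ?b \<tau> = 0" using agree_same_block_independent[OF V, of "\<lambda>\<tau>. ?a \<tau> - ?b \<tau>" \<tau>] \<tau> by blast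
  then show ?thesis by simp
qed

lemma ex_elem_expansion_proper:
  assumes V: "finite V" and E: "\<And>e. e \<in> E \<Longrightarrow> e \<subseteq> V" "\<And>e. e \<in> E \<Longrightarrow> card e = 2"
  shows "\<exists>c. elem_expansion V (proper E) c"
proof -
  have finE: "finite E" using V E(1) by (auto intro: finite_subset[of E "Pow V"])
  have "\<exists>c. elem_expansion V (\<lambda>\<kappa>. \<Sum>S\<in>Pow E. (-1) ^ card S * agree (adj S) \<kappa>) c"
    using E(1) by (intro ex_elem_expansion_sum ex_elem_expansion_agree[OF V] adj_subset) blast
  also have "(\<lambda>\<kappa>. \<Sum>S\<in>Pow E. (-1) ^ card S * agree (adj S) \<kappa>) = proper E"
    using proper_eq_sum_agree[OF finE E(2)] by auto
  finally show ?thesis .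
qed

section \<open>Positivity for trees\<close>

text \<open>Two vertices of a block are joined by edges of \<open>S\<close>, and no edge of
  \<open>S\<close> leaves a block, so the connection runs inside \<open>B\<close>.\<close>

lemma same_block_adj_connected:
  assumes \<tau>: "partition_on V \<tau>" "components V (adj S) = \<tau>" and B: "B \<in> \<tau>" and SE: "S \<subseteq> E"
    and E: "\<And>e. e \<in> E \<Longrightarrow> e \<subseteq> V"
  shows "connected_graph B (E \<inter> Pow B)"
  unfolding connected_graph_def
proof (intro ballI)
  fix u w assume "u \<in> B" "w \<in> B"
  then have "(u, w) \<in> same_block (components V (adj S))" using B \<tau> by (auto simp: same_block_def)
  then have uw: "(u, w) \<in> (adj S)\<^sup>*"
    by (auto simp: same_block_components insert_commute converse_unfold)
  have "adj S \<subseteq> same_block \<tau>"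
    using subset_same_block_components[of "adj S" V] \<tau>(2) adj_subset[of S V] SE E by blast
  then have stay: "z \<in> B" if "y \<in> B" "(y, z) \<in> adj S" for y z
    using that B partition_onD2[OF \<tau>(1)] by (fastforce simp: same_block_def disjoint_def)
  from uw have "(u, w) \<in> (adj (E \<inter> Pow B))\<^sup>* \<and> w \<in> B"
  proof (induction rule: rtrancl_induct)
    case base
    then show ?case using \<open>u \<in> B\<close> by simp
  next
    case (step y z)
    then have "z \<in> B" using stay by blast
    then have "(y, z) \<in> adj (E \<inter> Pow B)" using step SE by auto
    with step.IH have "(u, z) \<in> (adj (E \<inter> Pow B))\<^sup>*" by (meson rtrancl_into_rtrancl)
    then show ?case using \<open>z \<in> B\<close> by blast
  qed
  then show "(u, w) \<in> (adj (E \<inter> Pow B))\<^sup>*" ..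
qed

text \<open>The ends of an edge outside \<open>S\<close> would still be joined through
  \<open>S\<close>, contradicting \<open>tree_graph_bridge\<close>. Hence a single edge set
  contributes to the power sum of the one-block partition.\<close>

lemma tree_graph_spanning:
  assumes tree: "tree_graph V E" and S: "S \<subseteq> E" "components V (adj S) = {V}"
  shows "S = E"
proof (rule ccontr)
  assume "S \<noteq> E"
  then obtain e where e: "e \<in> E" "e \<notin> S" using S(1) by blast
  then obtain a b where ab: "e = {a, b}" "a \<in> V" "b \<in> V"
    using tree unfolding tree_graph_def simple_graph_def by (metis card_2_iff insert_subset)
  have "(a, b) \<in> same_block (components V (adj S))" using ab S(2) by (simp add: same_block_def)
  then have "(a, b) \<in> (adj S)\<^sup>*"
    by (auto simp: same_block_components insert_commute converse_unfold)
  moreover have "adj S \<subseteq> adj (E - {{a, b}})" using S(1) e ab by auto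
  ultimately have "(a, b) \<in> (adj (E - {{a, b}}))\<^sup>*" by (meson in_mono rtrancl_mono)
  then show False using tree_graph_bridge[OF tree] e ab by blast
qed

lemma tree_graph_components:
  assumes "tree_graph V E"
  shows "components V (adj E) = {V}"
proof (rule same_block_eqD[OF components_parts])
  have conn: "connected_graph V E" and "V \<noteq> {}"
    using assms by (auto simp: tree_graph_def simple_graph_def)
  then show "partition_on V {V}" by (simp add: partition_on_space)
  have "(a, b) \<in> (adj E \<union> (adj E)\<inverse>)\<^sup>*" if "a \<in> V" "b \<in> V" for a b
    using conn that rtrancl_mono[of "adj E" "adj E \<union> (adj E)\<inverse>"] by (auto simp: connected_graph_def)
  then show "same_block (components V (adj E)) = same_block {V}"
    by (auto simp: same_block_components) (auto simp: same_block_def)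
qed

section \<open>Partitions with one or two blocks\<close>

text \<open>Makes the type sum at \<open>({#}, card V)\<close> a single coefficient, that of the
  one-block partition.\<close>

lemma partition_type_single_block:
  assumes V: "finite V" and \<pi>: "partition_on V \<pi>" and r: "r \<in> V"
  shows "partition_type r \<pi> = ({#}, card V) \<longleftrightarrow> \<pi> = {V}"
proof
  note B = block_in[OF \<pi> r]
  assume t: "partition_type r \<pi> = ({#}, card V)"
  have "finite \<pi>" using finite_elements[OF V \<pi>] .
  then have "\<pi> - {block \<pi> r} = {}" using t by (simp add: partition_type_def mset_set_empty_iff)
  then have "\<pi> = {block \<pi> r}" using B by blast
  then show "\<pi> = {V}" using partition_onD1[OF \<pi>] by auto
next
  assume "\<pi> = {V}"
  moreover from this have "block \<pi> r = V" using \<pi> r block_eqI[of V \<pi> V r] by simp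
  ultimately show "partition_type r \<pi> = ({#}, card V)" by (simp add: partition_type_def)
qed

lemma partition_type_two_blocksD:
  assumes V: "finite V" and \<pi>: "partition_on V \<pi>" and r: "r \<in> V"
    and t: "partition_type r \<pi> = ({#k#}, b)"
  obtains B where "\<pi> = {B, V - B}" "r \<in> B" "B \<subseteq> V" "card B = b" "V - B \<noteq> {}"
proof -
  define B where "B = block \<pi> r"
  have B: "B \<in> \<pi>" "r \<in> B" using block_in[OF \<pi> r] by (auto simp: B_def)
  have "size (mset_set (\<pi> - {B})) = 1"
    using t by (metis B_def fst_conv partition_type_def size_image_mset size_single)
  then have "card (\<pi> - {B}) = 1" by simp
  then obtain C where C: "\<pi> - {B} = {C}" by (rule card_1_singletonE)
  have "C \<in> \<pi>" "C \<noteq> B" using C by auto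
  have \<pi>BC: "\<pi> = {B, C}" using C B by auto
  have "B \<inter> C = {}" using \<open>C \<in> \<pi>\<close> \<open>C \<noteq> B\<close> B partition_onD2[OF \<pi>] by (auto simp: disjoint_def)
  moreover have "V = B \<union> C" using partition_onD1[OF \<pi>] \<pi>BC by auto
  ultimately have "V - B = C" by auto
  moreover have "C \<noteq> {}" using \<open>C \<in> \<pi>\<close> partition_onD3[OF \<pi>] by auto
  moreover have "card B = b" using t by (simp add: partition_type_def B_def)
  ultimately show thesis using that[of B] B \<pi>BC \<open>V = B \<union> C\<close> by auto
qed

lemma partition_type_two_blocks:
  assumes V: "finite V" and B: "r \<in> B" "B \<subseteq> V" "V - B \<noteq> {}"
  shows "partition_on V {B, V - B}" "partition_type r {B, V - B} = ({#card V - card B#}, card B)"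
proof -
  show \<pi>: "partition_on V {B, V - B}" using B by (auto simp: partition_on_def disjoint_def)
  have "block {B, V - B} r = B" by (rule block_eqI[OF \<pi>]) (use B in auto)
  moreover have "{B, V - B} - {B} = {V - B}" using B by auto
  moreover have "card (V - B) = card V - card B" using V B by (simp add: card_Diff_subset finite_subset)
  ultimately show "partition_type r {B, V - B} = ({#card V - card B#}, card B)"
    by (simp add: partition_type_def)
qed

text \<open>Each of the two blocks stays together in \<open>\<pi>\<close>, so a single related pair
  across them would merge everything.\<close>

lemma above_two_blocks:
  assumes \<pi>: "partition_on V \<pi>" and B: "partition_on V {B, V - B}"
    and le: "same_block {B, V - B} \<subseteq> same_block \<pi>" and ne: "\<pi> \<noteq> {V}"
  shows "\<pi> = {B, V - B}"
proof -
  have BV: "B \<noteq> {}" "B \<subseteq> V" "V - B \<noteq> {}" using partition_onD3[OF B] partition_onD1[OF B] by auto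
  obtain b c where bc: "b \<in> B" "c \<in> V - B" using BV by blast
  have inB: "(b, x) \<in> same_block \<pi>" if "x \<in> B" for x
    using le that bc by (auto simp: same_block_def)
  have inC: "(c, x) \<in> same_block \<pi>" if "x \<in> V - B" for x
    using le that bc by (auto simp: same_block_def)
  have "(b, c) \<notin> same_block \<pi>"
  proof
    assume "(b, c) \<in> same_block \<pi>"
    then have "(b, x) \<in> same_block \<pi>" if "x \<in> V" for x
      using that inB inC same_block_trans[OF \<pi>] by blast
    then have "(x, y) \<in> same_block \<pi>" if "x \<in> V" "y \<in> V" for x y
      using that by (meson same_block_sym same_block_trans[OF \<pi>])
    then have "same_block \<pi> = V \<times> V" using same_block_subset[OF \<pi>] by auto
    also have "\<dots> = same_block {V}" by (auto simp: same_block_def)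
    finally have "same_block \<pi> = same_block {V}" .
    then have "\<pi> = {V}" using same_block_eqD[OF \<pi> partition_on_space] bc by blast
    with ne show False ..
  qed
  then have cross: "(x, y) \<notin> same_block \<pi>" if "x \<in> B" "y \<in> V - B" for x y
    using inB[OF that(1)] inC[OF that(2)] \<pi> by (meson same_block_sym same_block_trans)
  have "same_block \<pi> \<subseteq> same_block {B, V - B}"
  proof clarify
    fix x y assume xy: "(x, y) \<in> same_block \<pi>"
    then have "x \<in> V" "y \<in> V" using same_block_subset[OF \<pi>] by auto
    then show "(x, y) \<in> same_block {B, V - B}"
      using cross[of x y] cross[of y x] xy same_block_sym[OF xy] by (auto simp: same_block_def[of "{B, V - B}"])
  qed
  with le show ?thesis using same_block_eqD[OF \<pi> B] by blast
qed

text \<open>The coefficient of \<open>p\<^sub>\<tau>\<close> in \<open>Y\<^sub>T\<close>, for a partition \<open>\<tau>\<close> into two blocks, only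
  receives contributions from \<open>e\<^sub>\<tau>\<close> and \<open>e\<^bsub>{V}\<^esub>\<close>, with the same sign. If it vanishes, the
  coefficients of \<open>e\<^sub>\<tau>\<close> and of \<open>e\<^bsub>{V}\<^esub>\<close> have opposite signs.\<close>

lemma tree_positive_imp_split:
  assumes tree: "tree_graph V E" and r: "r \<in> V"
    and c: "elem_expansion V (proper E) c"
    and pos1: "type_sum V r c ({#}, card V) \<ge> 0"
    and pos2: "type_sum V r c ({#card V - b#}, b) \<ge> 0"
    and b: "1 \<le> b" "b < card V"
  shows "\<exists>B. r \<in> B \<and> B \<subseteq> V \<and> card B = b \<and>
      connected_graph B (E \<inter> Pow B) \<and> connected_graph (V - B) (E \<inter> Pow (V - B))"
proof (rule ccontr)
  assume no_split: "\<not> ?thesis"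
  have V: "finite V" and E: "\<And>e. e \<in> E \<Longrightarrow> e \<subseteq> V" "\<And>e. e \<in> E \<Longrightarrow> card e = 2"
    using tree by (auto simp: tree_graph_def simple_graph_def)
  let ?m = "elem_coeff V"
  have coeff: "(\<Sum>\<pi>\<in>parts V. c \<pi> * ?m \<pi> \<tau>) = (\<Sum>S | S \<subseteq> E \<and> components V (adj S) = \<tau>. (-1) ^ card S)"
    if "partition_on V \<tau>" for \<tau>
    by (rule proper_expansion_agree_coeff[OF V _ _ c that]) (use E in auto)
  have top: "partition_on V {V}" using r by (intro partition_on_space) auto
  have le_top: "same_block \<tau> \<subseteq> same_block {V}" if "partition_on V \<tau>" for \<tau>
    using same_block_subset[OF that] by (auto simp: same_block_def[of "{V}"])
  have "{\<pi>. partition_on V \<pi> \<and> partition_type r \<pi> = ({#}, card V)} = {{V}}"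
    using partition_type_single_block[OF V _ r] top by blast
  then have c_top: "c {V} \<ge> 0" using pos1 by (simp add: type_sum_def)
  \<comment> \<open>The power sum of the one-block partition occurs only in \<open>elem {V}\<close>,
    while in the tree it has coefficient 1 or -1, coming from the full edge set.\<close>
  have "c {V} \<noteq> 0"
  proof
    assume "c {V} = 0"
    moreover have "?m \<pi> {V} = 0" if "\<pi> \<in> parts V - {{V}}" for \<pi>
      using elem_coeff_nonzeroD[of V \<pi> "{V}"] le_top[of \<pi>] same_block_eqD[OF _ top, of \<pi>] that by blast
    ultimately have "(\<Sum>\<pi>\<in>parts V. c \<pi> * ?m \<pi> {V}) = 0"
      by (intro sum.neutral) (metis Diff_iff mult_zero_left mult_zero_right singletonD)
    then have "(\<Sum>S | S \<subseteq> E \<and> components V (adj S) = {V}. (-1) ^ card S) = (0 :: rat)"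
      using coeff[OF top] by simp
    moreover have "{S. S \<subseteq> E \<and> components V (adj S) = {V}} = {E}"
      using tree_graph_spanning[OF tree] tree_graph_components[OF tree] by blast
    ultimately show False by simp
  qed
  with c_top have c_top: "c {V} > 0" by simp
  let ?T = "{\<pi>. partition_on V \<pi> \<and> partition_type r \<pi> = ({#card V - b#}, b)}"
  have neg: "c \<tau> < 0" if "\<tau> \<in> ?T" for \<tau>
  proof -
    have \<tau>: "partition_on V \<tau>" and type: "partition_type r \<tau> = ({#card V - b#}, b)"
      using that by simp_all
    obtain B where B: "\<tau> = {B, V - B}" "r \<in> B" "B \<subseteq> V" "card B = b" "V - B \<noteq> {}"
      by (rule partition_type_two_blocksD[OF V \<tau> r type])
    have "\<tau> \<noteq> {V}" using B by auto
    have none: "{S. S \<subseteq> E \<and> components V (adj S) = \<tau>} = {}"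
    proof (rule ccontr)
      assume "{S. S \<subseteq> E \<and> components V (adj S) = \<tau>} \<noteq> {}"
      then obtain S where "S \<subseteq> E" "components V (adj S) = \<tau>" by blast
      then have "connected_graph C (E \<inter> Pow C)" if "C \<in> \<tau>" for C
        using same_block_adj_connected[OF \<tau> _ that _ E(1)] by blast
      then show False using no_split B by blast
    qed
    have "(\<Sum>\<pi>\<in>parts V. c \<pi> * ?m \<pi> \<tau>) = 0" unfolding coeff[OF \<tau>] none by simp
    moreover have "(\<Sum>\<pi>\<in>parts V. c \<pi> * ?m \<pi> \<tau>) = (\<Sum>\<pi>\<in>{\<tau>, {V}}. c \<pi> * ?m \<pi> \<tau>)"
    proof (rule sum.mono_neutral_right)
      show "\<forall>\<pi>\<in>parts V - {\<tau>, {V}}. c \<pi> * ?m \<pi> \<tau> = 0"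
      proof
        fix \<pi> assume \<pi>: "\<pi> \<in> parts V - {\<tau>, {V}}"
        then have "\<not> same_block \<tau> \<subseteq> same_block \<pi>"
          using above_two_blocks[of V \<pi> B] \<tau> B(1) by blast
        then show "c \<pi> * ?m \<pi> \<tau> = 0" using elem_coeff_nonzeroD[of V \<pi> \<tau>] \<pi> by auto
      qed
    qed (use finite_parts[OF V] \<tau> top in auto)
    ultimately have "c \<tau> * ?m \<tau> \<tau> + c {V} * ?m {V} \<tau> = 0" using \<open>\<tau> \<noteq> {V}\<close> by simp
    \<comment> \<open>Multiplying by the common sign makes both \<open>?m \<tau> \<tau>\<close> and
      \<open>?m {V} \<tau>\<close> positive.\<close>
    then have "block_sign V \<tau> * (c \<tau> * ?m \<tau> \<tau> + c {V} * ?m {V} \<tau>) = 0" by simp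
    then have "c \<tau> * (block_sign V \<tau> * ?m \<tau> \<tau>) = - (c {V} * (block_sign V \<tau> * ?m {V} \<tau>))"
      by (simp add: algebra_simps)
    moreover have "c {V} * (block_sign V \<tau> * ?m {V} \<tau>) > 0"
      using c_top elem_coeff_pos[OF V top \<tau> le_top[OF \<tau>]] by simp
    ultimately have "c \<tau> * (block_sign V \<tau> * ?m \<tau> \<tau>) < 0" by simp
    then show "c \<tau> < 0"
      using elem_coeff_pos[OF V \<tau> \<tau>] by (meson less_asym mult_less_0_iff subset_refl)
  qed
  \<comment> \<open>Any set of \<open>b\<close> vertices containing \<open>r\<close> yields a
    partition of this type. With at least one negative summand the type sum is strictly
    negative.\<close>
  have "?T \<noteq> {}"
  proof -
    have "card (V - {r}) \<ge> b - 1" using b r V by simp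
    then obtain A where A: "A \<subseteq> V - {r}" "card A = b - 1" "finite A"
      by (rule obtain_subset_with_card_n)
    then have "r \<notin> A" by blast
    then have B: "card (insert r A) = b" "insert r A \<subseteq> V" using A b r by auto
    then have "insert r A \<noteq> V" using b by auto
    then have "V - insert r A \<noteq> {}" using B(2) by blast
    then show ?thesis using partition_type_two_blocks[OF V, of r "insert r A"] B by auto
  qed
  moreover have "finite ?T" using finite_subset[OF _ finite_parts[OF V], of ?T] by auto
  ultimately have "(\<Sum>\<tau>\<in>?T. c \<tau>) < (\<Sum>\<tau>\<in>?T. 0)" using neg by (intro sum_strict_mono) auto
  then show False using pos2 by (simp add: type_sum_def)
qed

lemma tree_positive_iff_path:
  assumes tree: "tree_graph {1..d} E" and d: "d \<ge> 1"
  shows "(\<forall>t\<in>ubc_index d. Poly_Mapping.lookup (ubc_y d E) t \<ge> 0) \<longleftrightarrow> path_with_endpoint {1..d} E d"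
proof
  have E: "\<And>e. e \<in> E \<Longrightarrow> e \<subseteq> {1..d}" "\<And>e. e \<in> E \<Longrightarrow> card e = 2"
    using tree by (auto simp: tree_graph_def simple_graph_def)
  have "\<exists>c. elem_expansion {1..d} (proper E) c" by (rule ex_elem_expansion_proper) (use E in auto)
  then obtain c where c: "elem_expansion {1..d} (proper E) c" ..
  have lookup: "Poly_Mapping.lookup (ubc_y d E) t = type_sum {1..d} d c t" for t
    by (rule lookup_ubc_y[OF E(1) c])
  {
    assume pos: "\<forall>t\<in>ubc_index d. Poly_Mapping.lookup (ubc_y d E) t \<ge> 0"
    show "path_with_endpoint {1..d} E d"
    proof (rule tree_path_with_endpoint[OF tree])
      show "d \<in> {1..d}" using d by simp
      fix b assume b: "1 \<le> b" "b < card {1..d}"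
      have "({#}, d) \<in> ubc_index d" "({#d - b#}, b) \<in> ubc_index d"
        using b d by (auto simp: ubc_index_def)
      then have "type_sum {1..d} d c ({#}, d) \<ge> 0" "type_sum {1..d} d c ({#d - b#}, b) \<ge> 0"
        using pos lookup by metis+
      then show "\<exists>B. d \<in> B \<and> B \<subseteq> {1..d} \<and> card B = b \<and> connected_graph B (E \<inter> Pow B) \<and>
          connected_graph ({1..d} - B) (E \<inter> Pow ({1..d} - B))"
        using b d by (intro tree_positive_imp_split[OF tree _ c]) auto
    qed
  next
    assume "path_with_endpoint {1..d} E d"
    then obtain ys where ys: "ys \<noteq> []" "distinct ys" "set ys = {1..d}" "E = consecutive_pairs ys"
      "d = hd ys \<or> d = last ys"
      unfolding path_with_endpoint_def by blast
    \<comment> \<open>The list is reversed if necessary, so that \<open>d\<close> becomes the last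
      vertex, where the path is built up.\<close>
    define xs where "xs = (if d = last ys then ys else rev ys)"
    have xs: "xs \<noteq> []" "distinct xs" "set xs = {1..d}" "E = consecutive_pairs xs" "last xs = d"
      using ys by (auto simp: xs_def consecutive_pairs_rev last_rev)
    have "elem_positive {1..d} d (proper E)"
      using elem_positive_path[OF xs(1,2)] xs by simp
    then obtain q where q: "elem_expansion {1..d} (proper E) q" "\<And>t. type_sum {1..d} d q t \<ge> 0"
      by (auto simp: elem_positive_def)
    then show "\<forall>t\<in>ubc_index d. Poly_Mapping.lookup (ubc_y d E) t \<ge> 0"
      using lookup_ubc_y[OF E(1) q(1)] by simp
  }
qed

section \<open>Transport along a labelling of the vertices\<close>

lemma path_with_endpoint_image:
  assumes "inj_on f V" "path_with_endpoint V E v"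
  shows "path_with_endpoint (f ` V) ((`) f ` E) (f v)"
proof -
  obtain xs where xs: "xs \<noteq> []" "distinct xs" "set xs = V" "E = consecutive_pairs xs"
      "v = hd xs \<or> v = last xs"
    using assms(2) unfolding path_with_endpoint_def by blast
  then show ?thesis
    unfolding path_with_endpoint_def
    by (intro exI[of _ "map f xs"])
      (use assms(1) in \<open>auto simp: distinct_map consecutive_pairs_map hd_map last_map\<close>)
qed

lemma inv_into_image_edges:
  assumes "inj_on f V" "\<And>e. e \<in> E \<Longrightarrow> e \<subseteq> V"
  shows "(`) (inv_into V f) ` ((`) f ` E) = E"
proof -
  have "inv_into V f ` f ` e = e" if "e \<in> E" for e
    using inv_into_image_cancel[OF assms(1) assms(2)[OF that]] .
  then show ?thesis by (force simp: image_image)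
qed

lemma tree_graph_image:
  assumes f: "inj_on f V" and tree: "tree_graph V E"
  shows "tree_graph (f ` V) ((`) f ` E)"
proof -
  have E: "\<And>e. e \<in> E \<Longrightarrow> e \<subseteq> V" using tree by (auto simp: tree_graph_def simple_graph_def)
  have "simple_graph (f ` V) ((`) f ` E)"
    using tree f by (auto simp: tree_graph_def simple_graph_def card_image inj_on_subset)
  moreover have "connected_graph (f ` V) ((`) f ` E)"
    unfolding connected_graph_def
  proof clarify
    fix u w assume "u \<in> V" "w \<in> V"
    then have "(u, w) \<in> (adj E)\<^sup>*" using tree by (auto simp: tree_graph_def connected_graph_def)
    then show "(f u, f w) \<in> (adj ((`) f ` E))\<^sup>*"
    proof (induction rule: rtrancl_induct)
      case (step y z)
      then have "(f y, f z) \<in> adj ((`) f ` E)" by (auto intro: rev_image_eqI)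
      with step.IH show ?case by (rule rtrancl_into_rtrancl)
    qed simp
  qed
  moreover have "\<not> graph_cycle ((`) f ` E) ys" for ys
  proof
    assume cyc: "graph_cycle ((`) f ` E) ys"
    let ?g = "inv_into V f"
    have ys: "distinct ys" "length ys \<ge> 3" "consecutive_pairs ys \<subseteq> (`) f ` E" "{last ys, hd ys} \<in> (`) f ` E"
      using cyc by (auto simp: graph_cycle_def)
    have "ys \<noteq> []" using ys(2) by auto
    \<comment> \<open>Every vertex of a cycle lies on one of its edges, hence in the image of
      \<open>V\<close>, where the inverse of \<open>f\<close> is injective; the cycle can therefore
      be pulled back.\<close>
    have "y \<in> f ` V" if y: "y \<in> set ys" for y
    proof -
      obtain i where i: "i < length ys" "y = ys ! i" using y by (auto simp: in_set_conv_nth)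
      have "\<exists>e\<in>(`) f ` E. y \<in> e"
      proof (cases "Suc i < length ys")
        case True
        then have "{y, ys ! Suc i} \<in> (`) f ` E" using i ys(3) unfolding consecutive_pairs_def by blast
        then show ?thesis by blast
      next
        case False
        then have "y = last ys" using i \<open>ys \<noteq> []\<close> by (simp add: last_conv_nth le_less_Suc_eq not_less_eq)
        then show ?thesis using ys(4) by blast
      qed
      then show ?thesis using E by blast
    qed
    then have "inj_on ?g (set ys)" by (intro inj_on_subset[OF inj_on_inv_into[of "f ` V" f V]]) auto
    then have "distinct (map ?g ys)" using ys(1) by (simp add: distinct_map)
    moreover have "consecutive_pairs (map ?g ys) \<subseteq> E"
      using image_mono[OF ys(3), of "(`) ?g"] inv_into_image_edges[OF f E]
      by (simp add: consecutive_pairs_map)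
    moreover have "?g ` {last ys, hd ys} \<in> E"
      using imageI[OF ys(4), of "(`) ?g"] inv_into_image_edges[OF f E] by simp
    ultimately have "graph_cycle E (map ?g ys)"
      using ys(2) \<open>ys \<noteq> []\<close> by (auto simp: graph_cycle_def hd_map last_map)
    then show False using tree by (auto simp: tree_graph_def)
  qed
  ultimately show ?thesis by (auto simp: tree_graph_def)
qed

text \<open>Ensures that the choice in \<open>ubc_y_at\<close> does return a labelling. A bijection
  of the remaining vertices onto the smaller labels is extended by sending \<open>v\<close> to the
  largest one.\<close>

lemma ex_labelling:
  assumes "finite V" "v \<in> V"
  shows "\<exists>l. bij_betw l V {1..card V} \<and> l v = card V"
proof -
  have card: "card V \<ge> 1" using assms by (metis One_nat_def Suc_leI card_gt_0_iff empty_iff)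
  have "card (V - {v}) = card {1..<card V}" using assms by simp
  then obtain h where h: "bij_betw h (V - {v}) {1..<card V}"
    using assms(1) finite_same_card_bij[of "V - {v}" "{1..<card V}"] by auto
  then have "bij_betw (h(v := card V)) (V - {v}) {1..<card V}"
    by (subst bij_betw_cong[of _ _ h]) auto
  then have "bij_betw (h(v := card V)) (V - {v} \<union> {v}) ({1..<card V} \<union> {card V})"
    by (rule bij_betw_combine) auto
  moreover have "V - {v} \<union> {v} = V" "{1..<card V} \<union> {card V} = {1..card V}"
    using assms card by auto
  ultimately show ?thesis by (intro exI[of _ "h(v := card V)"]) simp
qed

theorem corollary7p3:
  fixes V :: "'a set" and E :: "'a set set" and v :: 'a
  assumes "tree_graph V E" and "v \<in> V"
  shows "e_positive_at V E v \<longleftrightarrow> path_with_endpoint V E v"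
proof -
  \<comment> \<open>The very labelling chosen in \<open>ubc_y_at\<close>, so that unfolding reduces
    the claim to the vertex set \<open>{1..card V}\<close>.\<close>
  define l where "l = (SOME l. bij_betw l V {1..card V} \<and> l v = card V)"
  have V: "finite V" and E: "\<And>e. e \<in> E \<Longrightarrow> e \<subseteq> V"
    using assms(1) by (auto simp: tree_graph_def simple_graph_def)
  have "bij_betw l V {1..card V} \<and> l v = card V"
    unfolding l_def by (rule someI_ex[OF ex_labelling[OF V assms(2)]])
  then have inj: "inj_on l V" and img: "l ` V = {1..card V}" and lv: "l v = card V"
    by (auto simp: bij_betw_def)
  have "tree_graph {1..card V} ((`) l ` E)" using tree_graph_image[OF inj assms(1)] img by simp
  moreover have "card V \<ge> 1" using V assms(2) by (metis One_nat_def Suc_leI card_gt_0_iff empty_iff)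
  ultimately have "e_positive_at V E v \<longleftrightarrow> path_with_endpoint {1..card V} ((`) l ` E) (card V)"
    using tree_positive_iff_path unfolding e_positive_at_def ubc_y_at_def l_def[symmetric] Let_def by blast
  also have "\<dots> \<longleftrightarrow> path_with_endpoint V E v"
  proof
    assume "path_with_endpoint {1..card V} ((`) l ` E) (card V)"
    then have "path_with_endpoint (l ` V) ((`) l ` E) (l v)" by (simp add: img lv)
    from path_with_endpoint_image[OF inj_on_inv_into[OF subset_refl] this]
    show "path_with_endpoint V E v"
      using inj assms(2) by (simp add: inv_into_image_edges[OF inj E] inv_into_image_cancel)
  next
    assume "path_with_endpoint V E v"
    then show "path_with_endpoint {1..card V} ((`) l ` E) (card V)"
      using path_with_endpoint_image[OF inj] img lv by metis
  qed
  finally show ?thesis .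
qed

end
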